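(* Each of the following three problems can be solved in time $2^{k+t}\cdot (k+t)^{O(\log(k+t))}\cdot n^{O(1)}$, where $n$ is the number of vertices of the input graph: (1) \textsc{Cutting at Most $k$ Vertices}: given $G=(V,E)$ and integers $k\ge1$, $t\ge0$, decide whether there is a non-empty $X\subseteq V$ with $|X|\le k$ and $|N(X)|\le t$; (2) \textsc{Cutting at Most $k$ Vertices with Terminal}: given $G=(V,E)$, $s\in V$ and integers $k\ge1$, $t\ge0$, decide whether there is a non-empty $X\subseteq V$ with $s\in X$, $|X|\le k$ and $|N(X)|\le t$; (3) \textsc{Cutting at Most $k$ Vertices by Edge-Cut with Terminal}: given $G=(V,E)$, $s\in V$ and integers $k\ge1$, $t\ge0$, decide whether there is $X\subseteq V$ with $s\in X$, $|X|\le k$ and $|\partial(X)|\le t$.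
   Context: All graphs are finite, simple and undirected. For $U\subseteq V$, $N(U)=\bigcup_{v\in U}N(v)\setminus U$ and $\partial(U)=\{uv\in E: u\in U, v\in V\setminus U\}$. *)

theory Defs
  imports Complex_Main "HOL-Library.Log_Nat"
begin

definition simple_graph :: "'a set \<Rightarrow> 'a set set \<Rightarrow> bool" where
  "simple_graph V E \<longleftrightarrow>
     finite V \<and> (\<forall>e\<in>E. \<exists>u v. u \<in> V \<and> v \<in> V \<and> u \<noteq> v \<and> e = {u, v})"

definition neighbours :: "'a set \<Rightarrow> 'a set set \<Rightarrow> 'a \<Rightarrow> 'a set" where
  "neighbours V E v = {u \<in> V. {u, v} \<in> E}"

definition open_nbhd :: "'a set \<Rightarrow> 'a set set \<Rightarrow> 'a set \<Rightarrow> 'a set" where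
  "open_nbhd V E U = (\<Union>v\<in>U. neighbours V E v) - U"

definition edge_boundary :: "'a set \<Rightarrow> 'a set set \<Rightarrow> 'a set \<Rightarrow> 'a set set" where
  "edge_boundary V E U = {{u, v} |u v. {u, v} \<in> E \<and> u \<in> U \<and> v \<in> V - U}"

definition cutting_vertices ::
  "'a set \<Rightarrow> 'a set set \<Rightarrow> nat \<Rightarrow> nat \<Rightarrow> bool" where
  "cutting_vertices V E k t \<longleftrightarrow>
     (\<exists>X\<subseteq>V. X \<noteq> {} \<and> card X \<le> k \<and> card (open_nbhd V E X) \<le> t)"

definition cutting_vertices_terminal ::
  "'a set \<Rightarrow> 'a set set \<Rightarrow> 'a \<Rightarrow> nat \<Rightarrow> nat \<Rightarrow> bool" where
  "cutting_vertices_terminal V E s k t \<longleftrightarrow>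
     (\<exists>X\<subseteq>V. X \<noteq> {} \<and> s \<in> X \<and> card X \<le> k \<and> card (open_nbhd V E X) \<le> t)"

definition cutting_vertices_edge_cut_terminal ::
  "'a set \<Rightarrow> 'a set set \<Rightarrow> 'a \<Rightarrow> nat \<Rightarrow> nat \<Rightarrow> bool" where
  "cutting_vertices_edge_cut_terminal V E s k t \<longleftrightarrow>
     (\<exists>X\<subseteq>V. s \<in> X \<and> card X \<le> k \<and> card (edge_boundary V E X) \<le> t)"


text \<open>
  The machine model is a deterministic random access machine over natural numbers with addition,
  truncated subtraction and indirect addressing, under the logarithmic cost criterion of Cook and
  Reckhow (each operand and each indirect address is charged its binary length), so that large
  numbers cannot be used to obtain work for free. Control flow is given by structured programs
  instead of jumps; this changes running times by a constant factor only. A state consists of the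
  registers and the memory; a program mentions only finitely many registers.
\<close>

type_synonym state = "(nat \<Rightarrow> nat) \<times> (nat \<Rightarrow> nat)"

datatype com =
    Skip
  | Imm nat nat         (* r[x] := c *)
  | Mov nat nat         (* r[x] := r[y] *)
  | Add nat nat nat     (* r[x] := r[y] + r[z] *)
  | Sub nat nat nat     (* r[x] := r[y] - r[z], truncated at 0 *)
  | Load nat nat        (* r[x] := m[r[y]] *)
  | Store nat nat       (* m[r[x]] := r[y] *)
  | Seq com com
  | IfNZ nat com com    (* test r[x] \<noteq> 0 *)
  | WhileNZ nat com

definition bitlength :: "nat \<Rightarrow> nat" where
  "bitlength v = max 1 (floorlog 2 v)"

inductive exec :: "com \<Rightarrow> state \<Rightarrow> nat \<Rightarrow> state \<Rightarrow> bool" where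
  Skip: "exec Skip (r, m) 1 (r, m)"
| Imm: "exec (Imm x c) (r, m) (bitlength c) (r(x := c), m)"
| Mov: "exec (Mov x y) (r, m) (bitlength (r y)) (r(x := r y), m)"
| Add: "exec (Add x y z) (r, m) (bitlength (r y) + bitlength (r z)) (r(x := r y + r z), m)"
| Sub: "exec (Sub x y z) (r, m) (bitlength (r y) + bitlength (r z)) (r(x := r y - r z), m)"
| Load: "exec (Load x y) (r, m) (bitlength (r y) + bitlength (m (r y))) (r(x := m (r y)), m)"
| Store: "exec (Store x y) (r, m) (bitlength (r x) + bitlength (r y)) (r, m(r x := r y))"
| Seq: "exec p st T st' \<Longrightarrow> exec q st' T' st'' \<Longrightarrow> exec (Seq p q) st (T + T') st''"
| IfTrue: "r x \<noteq> 0 \<Longrightarrow> exec p (r, m) T st' \<Longrightarrow>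
    exec (IfNZ x p q) (r, m) (bitlength (r x) + T) st'"
| IfFalse: "r x = 0 \<Longrightarrow> exec q (r, m) T st' \<Longrightarrow>
    exec (IfNZ x p q) (r, m) (bitlength (r x) + T) st'"
| WhileFalse: "r x = 0 \<Longrightarrow> exec (WhileNZ x p) (r, m) (bitlength (r x)) (r, m)"
| WhileTrue: "r x \<noteq> 0 \<Longrightarrow> exec p (r, m) T st' \<Longrightarrow> exec (WhileNZ x p) st' T' st'' \<Longrightarrow>
    exec (WhileNZ x p) (r, m) (bitlength (r x) + T + T') st''"

inductive_cases exec_elims:
  "exec Skip st T st'" "exec (Imm x c) st T st'" "exec (Mov x y) st T st'"
  "exec (Add x y z) st T st'" "exec (Sub x y z) st T st'" "exec (Load x y) st T st'"
  "exec (Store x y) st T st'" "exec (Seq p q) st T st'" "exec (IfNZ x p q) st T st'"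
inductive_cases exec_WhileE: "exec (WhileNZ x p) st T st'"

lemma exec_deterministic:
  "exec p st T1 st1 \<Longrightarrow> exec p st T2 st2 \<Longrightarrow> T1 = T2 \<and> st1 = st2"
proof (induction arbitrary: T2 st2 rule: exec.induct)
  case (Seq p st T st' q T' st'')
  from Seq.prems obtain S sta S' where a: "T2 = S + S'" "exec p st S sta" "exec q sta S' st2"
    by (rule exec_elims)
  from a(2) Seq.IH(1) have "T = S" "st' = sta" by blast+
  with a(3) Seq.IH(2) have "T' = S'" "st'' = st2" by blast+
  with \<open>T = S\<close> a(1) show ?case by simp
next
  case (IfTrue r x p m T st' q)
  from IfTrue.prems IfTrue.hyps(1) obtain S where a: "T2 = bitlength (r x) + S" "exec p (r, m) S st2"
    by (elim exec_elims) simp_all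
  from a(2) IfTrue.IH have "T = S \<and> st' = st2" by blast
  with a(1) show ?case by simp
next
  case (IfFalse r x q m T st' p)
  from IfFalse.prems IfFalse.hyps(1) obtain S where a: "T2 = bitlength (r x) + S" "exec q (r, m) S st2"
    by (elim exec_elims) simp_all
  from a(2) IfFalse.IH have "T = S \<and> st' = st2" by blast
  with a(1) show ?case by simp
next
  case (WhileFalse r x p m)
  from WhileFalse.prems show ?case
    by (rule exec_WhileE) (use WhileFalse.hyps in auto)
next
  case (WhileTrue r x p m T st' T' st'')
  from WhileTrue.prems show ?case
  proof (rule exec_WhileE)
    fix r' m' assume "st2 = (r', m')" "(r, m) = (r', m')" "r' x = 0"
    with WhileTrue.hyps show ?thesis by simp
  next
    fix r' m' S sta S'
    assume a: "T2 = bitlength (r' x) + S + S'" "(r, m) = (r', m')"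
      "exec p (r', m') S sta" "exec (WhileNZ x p) sta S' st2"
    from a(2,3) WhileTrue.IH(1) have "T = S" "st' = sta" by blast+
    with a(4) WhileTrue.IH(2) have "T' = S'" "st'' = st2" by blast+
    with \<open>T = S\<close> a(1,2) show ?thesis by simp
  qed
qed (erule exec_elims; simp)+

definition initial_state :: "nat list \<Rightarrow> state" where
  "initial_state xs = ((\<lambda>_. 0), (\<lambda>i. if i < length xs then xs ! i else 0))"

definition decides_within :: "com \<Rightarrow> nat list \<Rightarrow> bool \<Rightarrow> real \<Rightarrow> bool" where
  "decides_within p xs answer B \<longleftrightarrow>
     (\<exists>T r m. exec p (initial_state xs) T (r, m) \<and> real T \<le> B \<and> r 0 = of_bool answer)"

definition adjacency_matrix :: "nat \<Rightarrow> nat set set \<Rightarrow> nat list" where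
  "adjacency_matrix n E =
     concat (map (\<lambda>u. map (\<lambda>v. of_bool ({u, v} \<in> E)) [0..<n]) [0..<n])"

text \<open>
  The bound \<open>2^(k+t) * (k+t)^O(log(k+t)) * n^O(1)\<close> with the constants hidden in the exponents (\<open>a\<close> and \<open>c\<close>)
  and the multiplicative constant \<open>C\<close> made explicit. The maximum only matters for the empty graph,
  where \<open>n ^ c\<close> would be 0.
\<close>

definition time_bound :: "real \<Rightarrow> real \<Rightarrow> nat \<Rightarrow> nat \<Rightarrow> nat \<Rightarrow> nat \<Rightarrow> real" where
  "time_bound C a c n k t =
     C * 2 ^ (k + t) * real (k + t) powr (a * log 2 (real (k + t))) * real (max 1 n) ^ c"

end

theory Submission
  imports Defs
begin

text \<open>
  Grow \<open>X\<close> from a terminal \<open>s\<close>: whenever an unmarked neighbour of \<open>X\<close> is met, it is either put into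
  \<open>X\<close> or rejected for good. If \<open>D\<close> is a solution containing \<open>s\<close>, then deciding by membership in \<open>D\<close>
  puts only vertices of \<open>D\<close> into \<open>X\<close> and rejects only vertices of \<open>N(D)\<close>, so at most
  \<open>|D| + |N(D)| \<le> k + t\<close> decisions are taken (for the edge version, \<open>|N(D)| \<le> |\<partial>(D)|\<close>). When no
  unmarked neighbour is left, \<open>X \<subseteq> D\<close> and \<open>N(X) \<subseteq> N(D)\<close>, hence also \<open>\<partial>(X) \<subseteq> \<partial>(D)\<close>, so \<open>X\<close> is
  itself a solution. It therefore suffices to try all \<open>2 ^ (k + t)\<close> decision strings and to check the
  set that each of them produces; this takes polynomially many steps per string and needs no universal
  sets. The factor \<open>k + t\<close> from the length of the strings and from the logarithmic cost of arithmetic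
  on them is absorbed by \<open>(k + t) powr log 2 (k + t)\<close>.
\<close>

section \<open>Timed program logic\<close>

definition bounded :: "nat \<Rightarrow> (nat \<Rightarrow> nat) \<Rightarrow> (nat \<Rightarrow> nat) \<Rightarrow> bool" where
  "bounded W r m \<longleftrightarrow> 0 < W \<and> (\<forall>x. r x < 2 ^ W) \<and> (\<forall>i. m i < 2 ^ W)"

text \<open>\<open>B\<close> counts elementary instructions and tests. Under
  \<open>bounded W\<close> each of them is charged for at most two numbers of at most
  \<open>W\<close> binary digits, hence the factor \<open>2 * W\<close>. Since
  \<open>bounded W\<close> is both assumed and re-established, triples compose without mentioning
  number sizes.\<close>

definition runs ::
  "nat \<Rightarrow> com \<Rightarrow> (nat \<Rightarrow> nat) \<Rightarrow> (nat \<Rightarrow> nat) \<Rightarrow> nat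
    \<Rightarrow> ((nat \<Rightarrow> nat) \<Rightarrow> (nat \<Rightarrow> nat) \<Rightarrow> bool) \<Rightarrow> bool" where
  "runs W p r m B Q \<longleftrightarrow> (bounded W r m \<longrightarrow>
     (\<exists>T r' m'. exec p (r, m) T (r', m') \<and> T \<le> 2 * W * B \<and> bounded W r' m' \<and> Q r' m'))"

lemma bitlength_le: "v < 2 ^ W \<Longrightarrow> 0 < W \<Longrightarrow> bitlength v \<le> W"
  by (simp add: bitlength_def floorlog_leI)

lemma bounded_bitlength:
  assumes "bounded W r m"
  shows "bitlength (r x) \<le> W" "bitlength (m i) \<le> W"
  using assms by (auto simp: bounded_def intro: bitlength_le)

lemma runs_mono:
  assumes "runs W p r m B Q" "B \<le> B'" "\<And>r' m'. Q r' m' \<Longrightarrow> Q' r' m'"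
  shows "runs W p r m B' Q'"
proof -
  have "2 * W * B \<le> 2 * W * B'" using assms(2) by simp
  then show ?thesis using assms(1,3) unfolding runs_def by (meson le_trans)
qed

lemma runs_Seq:
  assumes "runs W p r m B1 R" "\<And>r' m'. R r' m' \<Longrightarrow> runs W q r' m' B2 Q"
  shows "runs W (Seq p q) r m (B1 + B2) Q"
  unfolding runs_def
proof
  assume "bounded W r m"
  then obtain T r' m' where 1: "exec p (r, m) T (r', m')" "T \<le> 2 * W * B1"
      "bounded W r' m'" "R r' m'"
    using assms(1) unfolding runs_def by blast
  then obtain T' r'' m'' where 2: "exec q (r', m') T' (r'', m'')" "T' \<le> 2 * W * B2"
      "bounded W r'' m''" "Q r'' m''"
    using assms(2) unfolding runs_def by blast
  have "T + T' \<le> 2 * W * (B1 + B2)" using 1(2) 2(2) by (simp add: distrib_left)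
  then show "\<exists>T r' m'. exec (Seq p q) (r, m) T (r', m') \<and> T \<le> 2 * W * (B1 + B2) \<and>
      bounded W r' m' \<and> Q r' m'"
    using exec.Seq[OF 1(1) 2(1)] 2(3,4) by blast
qed

text \<open>Register \<open>x\<close> is its own loop counter, so exactly \<open>N\<close> rounds
  take place. Each costs \<open>B\<close> plus one unit for its test; the last unit is the failing
  test.\<close>

lemma runs_WhileNZ:
  assumes "I N r m"
    and "\<And>j r m. I j r m \<Longrightarrow> r x = j"
    and "\<And>j r m. I (Suc j) r m \<Longrightarrow> runs W p r m B (I j)"
  shows "runs W (WhileNZ x p) r m (N * (B + 1) + 1) (I 0)"
  using assms(1)
proof (induction N arbitrary: r m)
  case 0
  have "exec (WhileNZ x p) (r, m) (bitlength (r x)) (r, m)"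
    using assms(2)[OF 0] by (intro exec.WhileFalse) simp
  moreover have "bitlength (r x) \<le> 2 * W * 1" if "bounded W r m"
    using bounded_bitlength(1)[OF that, of x] by simp
  ultimately show ?case using 0 unfolding runs_def by (metis mult_0 add_0)
next
  case (Suc N)
  show ?case unfolding runs_def
  proof
    assume b: "bounded W r m"
    then obtain T r' m' where 1: "exec p (r, m) T (r', m')" "T \<le> 2 * W * B"
        "bounded W r' m'" "I N r' m'"
      using assms(3)[OF Suc.prems] unfolding runs_def by blast
    obtain T' r'' m'' where 2: "exec (WhileNZ x p) (r', m') T' (r'', m'')"
        "T' \<le> 2 * W * (N * (B + 1) + 1)" "bounded W r'' m''" "I 0 r'' m''"
      using Suc.IH[OF 1(4)] 1(3) unfolding runs_def by blast
    have e: "exec (WhileNZ x p) (r, m) (bitlength (r x) + T + T') (r'', m'')"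
      using assms(2)[OF Suc.prems] 1(1) 2(1) by (intro exec.WhileTrue) simp_all
    have "bitlength (r x) + T + T' \<le> 2 * W + 2 * W * B + 2 * W * (N * (B + 1) + 1)"
      using bounded_bitlength(1)[OF b, of x] 1(2) 2(2) by linarith
    also have "\<dots> = 2 * W * (Suc N * (B + 1) + 1)" by (simp add: algebra_simps)
    finally show "\<exists>T r' m'. exec (WhileNZ x p) (r, m) T (r', m') \<and>
        T \<le> 2 * W * (Suc N * (B + 1) + 1) \<and> bounded W r' m' \<and> I 0 r' m'"
      using e 2(3,4) by blast
  qed
qed

section \<open>Loop-free programs by symbolic evaluation\<close>

primrec loop_free :: "com \<Rightarrow> bool" where
  "loop_free Skip = True"
| "loop_free (Imm x c) = True"
| "loop_free (Mov x y) = True"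
| "loop_free (Add x y z) = True"
| "loop_free (Sub x y z) = True"
| "loop_free (Load x y) = True"
| "loop_free (Store x y) = True"
| "loop_free (Seq p q) = (loop_free p \<and> loop_free q)"
| "loop_free (IfNZ x p q) = (loop_free p \<and> loop_free q)"
| "loop_free (WhileNZ x p) = False"

text \<open>The values of \<open>effect\<close>, \<open>steps\<close> and \<open>fits\<close> on loops are junk.\<close>

primrec effect :: "com \<Rightarrow> state \<Rightarrow> state" where
  "effect Skip st = st"
| "effect (Imm x c) st = ((fst st)(x := c), snd st)"
| "effect (Mov x y) st = ((fst st)(x := fst st y), snd st)"
| "effect (Add x y z) st = ((fst st)(x := fst st y + fst st z), snd st)"
| "effect (Sub x y z) st = ((fst st)(x := fst st y - fst st z), snd st)"
| "effect (Load x y) st = ((fst st)(x := snd st (fst st y)), snd st)"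
| "effect (Store x y) st = (fst st, (snd st)(fst st x := fst st y))"
| "effect (Seq p q) st = effect q (effect p st)"
| "effect (IfNZ x p q) st = (if fst st x \<noteq> 0 then effect p st else effect q st)"
| "effect (WhileNZ x p) st = st"

primrec steps :: "com \<Rightarrow> nat" where
  "steps Skip = 1"
| "steps (Imm x c) = 1"
| "steps (Mov x y) = 1"
| "steps (Add x y z) = 1"
| "steps (Sub x y z) = 1"
| "steps (Load x y) = 1"
| "steps (Store x y) = 1"
| "steps (Seq p q) = steps p + steps q"
| "steps (IfNZ x p q) = 1 + (steps p + steps q)"
| "steps (WhileNZ x p) = 0"

primrec fits :: "nat \<Rightarrow> com \<Rightarrow> state \<Rightarrow> bool" where
  "fits W Skip st = True"
| "fits W (Imm x c) st = (c < 2 ^ W)"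
| "fits W (Mov x y) st = True"
| "fits W (Add x y z) st = (fst st y + fst st z < 2 ^ W)"
| "fits W (Sub x y z) st = True"
| "fits W (Load x y) st = True"
| "fits W (Store x y) st = True"
| "fits W (Seq p q) st = (fits W p st \<and> fits W q (effect p st))"
| "fits W (IfNZ x p q) st = (if fst st x \<noteq> 0 then fits W p st else fits W q st)"
| "fits W (WhileNZ x p) st = True"

text \<open>Only \<open>Imm\<close> and \<open>Add\<close> can create a number longer than those
  already present, so \<open>fits\<close> restricts just these two. A conditional is charged for
  both branches, which makes \<open>steps\<close> independent of the state.\<close>

lemma exec_loop_free:
  assumes "loop_free p" "fits W p (r, m)" "bounded W r m"
  shows "\<exists>T. exec p (r, m) T (effect p (r, m)) \<and> T \<le> 2 * W * steps p \<and>
    bounded W (fst (effect p (r, m))) (snd (effect p (r, m)))"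
  using assms
proof (induction p arbitrary: r m)
  case Skip
  then have "1 \<le> W" by (simp add: bounded_def)
  then show ?case using Skip by (auto intro!: exI[of _ 1] exec.Skip)
next
  case (Imm x c)
  then have "bitlength c \<le> W" by (auto simp: bounded_def intro: bitlength_le)
  then show ?case using Imm exec.Imm[of x c r m] by (fastforce simp: bounded_def)
next
  case (Mov x y)
  then show ?case using exec.Mov[of x y r m] bounded_bitlength(1)[OF Mov(3), of y]
    by (fastforce simp: bounded_def)
next
  case (Add x y z)
  then show ?case using exec.Add[of x y z r m] bounded_bitlength(1)[OF Add(3), of y]
      bounded_bitlength(1)[OF Add(3), of z]
    by (fastforce simp: bounded_def)
next
  case (Sub x y z)
  have "r y - r z < 2 ^ W" using Sub(3) by (simp add: bounded_def less_imp_diff_less)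
  then show ?case using Sub exec.Sub[of x y z r m] bounded_bitlength(1)[OF Sub(3), of y]
      bounded_bitlength(1)[OF Sub(3), of z]
    by (fastforce simp: bounded_def)
next
  case (Load x y)
  then show ?case using exec.Load[of x y r m] bounded_bitlength(1)[OF Load(3), of y]
      bounded_bitlength(2)[OF Load(3), of "r y"]
    by (fastforce simp: bounded_def)
next
  case (Store x y)
  then show ?case using exec.Store[of x y r m] bounded_bitlength(1)[OF Store(3), of y]
      bounded_bitlength(1)[OF Store(3), of x]
    by (fastforce simp: bounded_def)
next
  case (Seq p q)
  obtain r' m' where st: "effect p (r, m) = (r', m')" by (cases "effect p (r, m)")
  from Seq.IH(1)[of r m] Seq.prems st obtain T where
    1: "exec p (r, m) T (r', m')" "T \<le> 2 * W * steps p" "bounded W r' m'" by auto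
  from Seq.IH(2)[of r' m'] Seq.prems st 1(3) obtain T' where
    2: "exec q (r', m') T' (effect q (r', m'))" "T' \<le> 2 * W * steps q"
      "bounded W (fst (effect q (r', m'))) (snd (effect q (r', m')))" by auto
  have "T + T' \<le> 2 * W * (steps p + steps q)" using 1(2) 2(2) by (simp add: distrib_left)
  then show ?case using exec.Seq[OF 1(1) 2(1)] 2(3) st by auto
next
  case (IfNZ x p q)
  note b = bounded_bitlength(1)[OF IfNZ.prems(3), of x]
  show ?case
  proof (cases "r x = 0")
    case True
    with IfNZ.IH(2)[of r m] IfNZ.prems obtain T where
      1: "exec q (r, m) T (effect q (r, m))" "T \<le> 2 * W * steps q"
        "bounded W (fst (effect q (r, m))) (snd (effect q (r, m)))" by auto
    have "bitlength (r x) + T \<le> 2 * W * steps (IfNZ x p q)"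
      using b 1(2) by (simp add: distrib_left)
    then show ?thesis using exec.IfFalse[OF True 1(1), of p] 1(3) True by auto
  next
    case False
    with IfNZ.IH(1)[of r m] IfNZ.prems obtain T where
      1: "exec p (r, m) T (effect p (r, m))" "T \<le> 2 * W * steps p"
        "bounded W (fst (effect p (r, m))) (snd (effect p (r, m)))" by auto
    have "bitlength (r x) + T \<le> 2 * W * steps (IfNZ x p q)"
      using b 1(2) by (simp add: distrib_left)
    then show ?thesis using exec.IfTrue[OF False 1(1), of q] 1(3) False by auto
  qed
next
  case (WhileNZ x p)
  then show ?case by simp
qed

text \<open>Turns a triple about a loop-free program into an evaluation of \<open>effect\<close>,
  which simplification carries out.\<close>

lemma runs_loop_free:
  assumes "loop_free p" "fits W p (r, m)" "Q (fst (effect p (r, m))) (snd (effect p (r, m)))"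
    and "steps p \<le> B"
  shows "runs W p r m B Q"
proof -
  have "runs W p r m (steps p) Q"
    using exec_loop_free[OF assms(1,2)] assms(3) unfolding runs_def
    by (metis prod.collapse)
  then show ?thesis using assms(4) by (rule runs_mono)
qed

section \<open>The search procedure\<close>

text \<open>Indices run downwards because the machine loops count a register down to 0. In the
  invariant rule below, \<open>I q\<close> describes the state after the indices from
  \<open>q\<close> on have been treated.\<close>

abbreviation sweep :: "(nat \<Rightarrow> 'b \<Rightarrow> 'b) \<Rightarrow> nat \<Rightarrow> 'b \<Rightarrow> 'b" where
  "sweep f N \<equiv> fold f (rev [0..<N])"

lemma sweep_invariant:
  assumes "I N st" "\<And>q st. q < N \<Longrightarrow> I (Suc q) st \<Longrightarrow> I q (f q st)"
  shows "I 0 (sweep f N st)"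
  using assms
proof (induction N arbitrary: st)
  case (Suc N)
  then have "I N (f N st)" by simp
  then have "I 0 (sweep f N (f N st))" using Suc by (intro Suc.IH) auto
  then show ?case by simp
qed simp

text \<open>Flattens repeated sweeps into one fold, so that inductions run over a single list of
  pairs.\<close>

lemma funpow_fold: "(fold f xs ^^ j) st = fold f (concat (replicate j xs)) st"
  by (induction j arbitrary: st) (simp_all add: funpow_Suc_right del: funpow.simps(2))

text \<open>
  A marking maps every vertex to 3 (chosen, i.e. in the set \<open>X\<close> being grown), 1 (rejected), 2 (a
  neighbour of \<open>X\<close> that has been counted) or 0 (not seen yet). With these codes every test needed
  is a truncated subtraction followed by a comparison with 0. A number \<open>q < n * n\<close> stands for the
  ordered pair \<open>(q div n, q mod n)\<close>.
\<close>

definition chosen :: "nat \<Rightarrow> (nat \<Rightarrow> nat) \<Rightarrow> nat set" where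
  "chosen n \<sigma> = {v. v < n \<and> 2 < \<sigma> v}"

definition frontier :: "nat \<Rightarrow> nat set set \<Rightarrow> nat \<Rightarrow> (nat \<Rightarrow> nat) \<Rightarrow> bool" where
  "frontier n E q \<sigma> \<longleftrightarrow> {q div n, q mod n} \<in> E \<and> 2 < \<sigma> (q div n) \<and> \<sigma> (q mod n) = 0"

text \<open>The decision is the leading binary digit of the \<open>L\<close>-digit number \<open>x\<close>, which is shifted out.\<close>

definition explore ::
  "nat \<Rightarrow> nat set set \<Rightarrow> nat \<Rightarrow> nat \<Rightarrow> (nat \<Rightarrow> nat) \<times> nat \<Rightarrow> (nat \<Rightarrow> nat) \<times> nat" where
  "explore n E L q = (\<lambda>(\<sigma>, x).
     if frontier n E q \<sigma> then
       if 2 * x < 2 ^ L then (\<sigma>(q mod n := 1), 2 * x) else (\<sigma>(q mod n := 3), 2 * x - 2 ^ L)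
     else (\<sigma>, x))"

definition guided :: "nat \<Rightarrow> nat set set \<Rightarrow> nat set \<Rightarrow> nat \<Rightarrow> (nat \<Rightarrow> nat) \<Rightarrow> (nat \<Rightarrow> nat)" where
  "guided n E D q \<sigma> =
     (if frontier n E q \<sigma> then \<sigma>(q mod n := if q mod n \<in> D then 3 else 1) else \<sigma>)"

text \<open>The mark \<open>c\<close> selects what is counted. With \<open>c = 2\<close> a counted
  vertex no longer passes the test \<open>\<le> 1\<close>, so each neighbour counts once; with
  \<open>c = 1\<close> it still passes, so each pair leaving the chosen set counts.\<close>

definition tally ::
  "nat \<Rightarrow> nat set set \<Rightarrow> nat \<Rightarrow> nat \<Rightarrow> (nat \<Rightarrow> nat) \<times> nat \<Rightarrow> (nat \<Rightarrow> nat) \<times> nat" where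
  "tally n E c q = (\<lambda>(\<sigma>, b).
     if {q div n, q mod n} \<in> E \<and> 2 < \<sigma> (q div n) \<and> \<sigma> (q mod n) \<le> 1
     then (\<sigma>(q mod n := c), b + 1) else (\<sigma>, b))"

definition start :: "nat \<Rightarrow> nat \<Rightarrow> nat" where
  "start s = (\<lambda>_. 0)(s := 3)"

text \<open>A sweep that meets a frontier pair marks a new vertex, so \<open>n\<close> sweeps reach
  saturation as long as the decisions are those of a solution.\<close>

definition guess :: "nat \<Rightarrow> nat set set \<Rightarrow> nat \<Rightarrow> nat \<Rightarrow> nat \<Rightarrow> nat \<Rightarrow> nat" where
  "guess n E L s w = fst ((sweep (explore n E L) (n * n) ^^ n) (start s, w))"

definition accepts :: "nat \<Rightarrow> nat set set \<Rightarrow> nat \<Rightarrow> nat \<Rightarrow> nat \<Rightarrow> (nat \<Rightarrow> nat) \<Rightarrow> bool" where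
  "accepts n E k t c \<sigma> \<longleftrightarrow>
     card (chosen n \<sigma>) \<le> k \<and> snd (sweep (tally n E c) (n * n) (\<sigma>, 0)) \<le> t"

definition search :: "nat \<Rightarrow> nat set set \<Rightarrow> nat \<Rightarrow> nat \<Rightarrow> nat \<Rightarrow> nat \<Rightarrow> bool" where
  "search n E k t c s \<longleftrightarrow> (\<exists>w<2 ^ (k + t). accepts n E k t c (guess n E (k + t) s w))"

lemma pair_index:
  fixes n u v :: nat
  assumes "u < n" "v < n"
  shows "u * n + v < n * n" "(u * n + v) div n = u" "(u * n + v) mod n = v"
proof -
  have "u * n + v < Suc u * n" using assms by simp
  also have "\<dots> \<le> n * n" using assms by (intro mult_le_mono1) simp
  finally show "u * n + v < n * n" .
qed (use assms in auto)

lemma pair_bounds: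
  fixes n q :: nat
  assumes "q < n * n"
  shows "q div n < n" "q mod n < n"
proof -
  have "0 < n" using assms by (cases n) auto
  then show "q div n < n" "q mod n < n" using assms by (simp_all add: less_mult_imp_div_less)
qed

subsection \<open>Soundness of the final count\<close>

text \<open>Overwriting a mark 0 or 1 by 1 changes no later test, so the pairs are counted
  independently. The mark 2 must be absent initially: it is neither chosen nor countable.\<close>

lemma tally_edges:
  assumes "\<forall>v<n. \<sigma> v \<noteq> 2"
  shows "snd (sweep (tally n E 1) (n * n) (\<sigma>, 0)) =
    card {q. q < n * n \<and> {q div n, q mod n} \<in> E \<and> q div n \<in> chosen n \<sigma> \<and> q mod n \<notin> chosen n \<sigma>}"
proof -
  define S where "S j = {q. j \<le> q \<and> q < n * n \<and> {q div n, q mod n} \<in> E \<and>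
    q div n \<in> chosen n \<sigma> \<and> q mod n \<notin> chosen n \<sigma>}" for j
  define I where "I j st \<longleftrightarrow> snd st = card (S j) \<and>
    (\<forall>v<n. (2 < fst st v \<longleftrightarrow> v \<in> chosen n \<sigma>) \<and> fst st v \<noteq> 2)" for j and st :: "(nat \<Rightarrow> nat) \<times> nat"
  have "I 0 (sweep (tally n E 1) (n * n) (\<sigma>, 0))"
  proof (rule sweep_invariant)
    have "S (n * n) = {}" by (auto simp: S_def)
    then show "I (n * n) (\<sigma>, 0)" using assms by (auto simp: I_def chosen_def)
  next
    fix q st assume q: "q < n * n" and I: "I (Suc q) st"
    obtain \<tau> b where st: "st = (\<tau>, b)" by (cases st)
    note b = pair_bounds[OF q]
    have low: "\<tau> v \<le> 1 \<longleftrightarrow> v \<notin> chosen n \<sigma>" if "v < n" for v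
      using I that by (force simp: I_def st)
    have high: "2 < \<tau> v \<longleftrightarrow> v \<in> chosen n \<sigma>" if "v < n" for v
      using I that by (simp add: I_def st)
    define act where "act \<longleftrightarrow> {q div n, q mod n} \<in> E \<and> q div n \<in> chosen n \<sigma> \<and> q mod n \<notin> chosen n \<sigma>"
    have "S q = (if act then insert q (S (Suc q)) else S (Suc q))"
      using q by (auto simp: S_def act_def Suc_le_eq order_le_less)
    moreover have "finite (S (Suc q))" "q \<notin> S (Suc q)" by (auto simp: S_def)
    ultimately have "card (S q) = (if act then 1 else 0) + card (S (Suc q))" by simp
    moreover have "tally n E 1 q st = (if act then (\<tau>(q mod n := 1), b + 1) else (\<tau>, b))"
      using low[OF b(2)] high[OF b(1)] by (simp add: tally_def st act_def)
    ultimately show "I q (tally n E 1 q st)"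
      using I by (auto simp: I_def st act_def)
  qed
  then show ?thesis by (simp add: I_def S_def)
qed

text \<open>The mark 2 holds exactly on the vertices counted so far. The set \<open>S j\<close>
  collects the outside vertices reached from the chosen set by a pair of index at least
  \<open>j\<close>; several pairs may lead to the same vertex.\<close>

lemma tally_vertices:
  assumes "\<forall>v<n. \<sigma> v \<noteq> 2"
  shows "snd (sweep (tally n E 2) (n * n) (\<sigma>, 0)) =
    card {v. v < n \<and> v \<notin> chosen n \<sigma> \<and> (\<exists>u\<in>chosen n \<sigma>. {u, v} \<in> E)}"
proof -
  define S where "S j = {v. v < n \<and> v \<notin> chosen n \<sigma> \<and>
    (\<exists>u\<in>chosen n \<sigma>. {u, v} \<in> E \<and> j \<le> u * n + v)}" for j
  define I where "I j st \<longleftrightarrow> snd st = card (S j) \<and>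
    (\<forall>v<n. (2 < fst st v \<longleftrightarrow> v \<in> chosen n \<sigma>) \<and> (fst st v = 2 \<longleftrightarrow> v \<in> S j))"
    for j and st :: "(nat \<Rightarrow> nat) \<times> nat"
  have "I 0 (sweep (tally n E 2) (n * n) (\<sigma>, 0))"
  proof (rule sweep_invariant)
    have "S (n * n) = {}" using pair_index(1) by (fastforce simp: S_def chosen_def not_le)
    then show "I (n * n) (\<sigma>, 0)" using assms by (auto simp: I_def chosen_def)
  next
    fix q st assume q: "q < n * n" and I: "I (Suc q) st"
    obtain \<tau> b where st: "st = (\<tau>, b)" by (cases st)
    note b = pair_bounds[OF q]
    have low: "\<tau> v \<le> 1 \<longleftrightarrow> v \<notin> chosen n \<sigma> \<and> v \<notin> S (Suc q)" if "v < n" for v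
      using I that by (force simp: I_def st)
    have high: "2 < \<tau> v \<longleftrightarrow> v \<in> chosen n \<sigma>" if "v < n" for v
      using I that by (simp add: I_def st)
    define act where "act \<longleftrightarrow> {q div n, q mod n} \<in> E \<and> q div n \<in> chosen n \<sigma> \<and> q mod n \<notin> chosen n \<sigma>"
    have "S q = (if act then insert (q mod n) (S (Suc q)) else S (Suc q))"
    proof -
      have "v \<in> S q \<longleftrightarrow> v \<in> S (Suc q) \<or> act \<and> v = q mod n" for v
      proof -
        \<comment> \<open>Lowering the threshold from \<open>Suc q\<close> to \<open>q\<close>
          admits a single new pair, the one encoded by \<open>q\<close>.\<close>
        have "q \<le> u * n + v \<longleftrightarrow> Suc q \<le> u * n + v \<or> u = q div n \<and> v = q mod n"
          if "u < n" "v < n" for u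
        proof -
          have "q = u * n + v \<longleftrightarrow> u = q div n \<and> v = q mod n"
            using pair_index(2,3)[OF that] div_mult_mod_eq[of q n] by auto
          then show ?thesis by linarith
        qed
        then show ?thesis using b by (auto simp: S_def act_def chosen_def)
      qed
      then show ?thesis by auto
    qed
    moreover have "finite (S (Suc q))" by (auto simp: S_def)
    ultimately have "card (S q) = (if act \<and> q mod n \<notin> S (Suc q) then 1 else 0) + card (S (Suc q))"
      and S: "v \<in> S q \<longleftrightarrow> v \<in> S (Suc q) \<or> act \<and> v = q mod n" for v
      by (auto simp: card_insert_if)
    moreover have "tally n E 2 q st =
        (if act \<and> q mod n \<notin> S (Suc q) then (\<tau>(q mod n := 2), b + 1) else (\<tau>, b))"
      using low[OF b(2)] high[OF b(1)] by (simp add: tally_def st act_def)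
    ultimately show "I q (tally n E 2 q st)"
      using I by (auto simp: I_def st act_def)
  qed
  moreover have "S 0 = {v. v < n \<and> v \<notin> chosen n \<sigma> \<and> (\<exists>u\<in>chosen n \<sigma>. {u, v} \<in> E)}"
    by (simp add: S_def)
  ultimately show ?thesis by (simp add: I_def)
qed

lemma open_nbhd_lessThan:
  fixes n :: nat
  shows
  "open_nbhd {..<n} E X = {v. v < n \<and> v \<notin> X \<and> (\<exists>u\<in>X. {u, v} \<in> E)}"
  by (auto simp: open_nbhd_def neighbours_def insert_commute)

text \<open>Exactly one of the two orientations of a boundary edge leaves \<open>X\<close>, so
  counting ordered pairs does not count an edge twice.\<close>

lemma card_edge_boundary_lessThan:
  fixes n :: nat
  assumes "X \<subseteq> {..<n}"
  shows "card (edge_boundary {..<n} E X) =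
    card {q. q < n * n \<and> {q div n, q mod n} \<in> E \<and> q div n \<in> X \<and> q mod n \<notin> X}" (is "_ = card ?Q")
proof -
  have "bij_betw (\<lambda>q. {q div n, q mod n}) ?Q (edge_boundary {..<n} E X)"
    unfolding bij_betw_def
  proof
    show "inj_on (\<lambda>q. {q div n, q mod n}) ?Q"
    proof (rule inj_onI)
      fix q q' :: nat assume "q \<in> ?Q" "q' \<in> ?Q" "{q div n, q mod n} = {q' div n, q' mod n}"
      then have "q div n = q' div n" "q mod n = q' mod n" by (auto simp: doubleton_eq_iff)
      then have "q div n * n + q mod n = q' div n * n + q' mod n" by simp
      then show "q = q'" by (simp only: div_mult_mod_eq)
    qed
    show "(\<lambda>q. {q div n, q mod n}) ` ?Q = edge_boundary {..<n} E X"
    proof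
      show "(\<lambda>q. {q div n, q mod n}) ` ?Q \<subseteq> edge_boundary {..<n} E X"
        using pair_bounds by (fastforce simp: edge_boundary_def)
      show "edge_boundary {..<n} E X \<subseteq> (\<lambda>q. {q div n, q mod n}) ` ?Q"
      proof
        fix e assume "e \<in> edge_boundary {..<n} E X"
        then obtain u v where uv: "e = {u, v}" "{u, v} \<in> E" "u \<in> X" "v < n" "v \<notin> X"
          by (auto simp: edge_boundary_def)
        moreover have "u < n" using uv(3) assms by auto
        ultimately show "e \<in> (\<lambda>q. {q div n, q mod n}) ` ?Q"
          using pair_index[of u n v] by (intro image_eqI[of _ _ "u * n + v"]) auto
      qed
    qed
  qed
  then show ?thesis by (simp add: bij_betw_same_card)
qed

lemma accepts_vertices:
  assumes "\<forall>v<n. \<sigma> v \<noteq> 2"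
  shows "accepts n E k t 2 \<sigma> \<longleftrightarrow>
    card (chosen n \<sigma>) \<le> k \<and> card (open_nbhd {..<n} E (chosen n \<sigma>)) \<le> t"
  by (simp add: accepts_def tally_vertices[OF assms] open_nbhd_lessThan)

lemma accepts_edges:
  assumes "\<forall>v<n. \<sigma> v \<noteq> 2"
  shows "accepts n E k t 1 \<sigma> \<longleftrightarrow>
    card (chosen n \<sigma>) \<le> k \<and> card (edge_boundary {..<n} E (chosen n \<sigma>)) \<le> t"
proof -
  have "chosen n \<sigma> \<subseteq> {..<n}" by (auto simp: chosen_def)
  then show ?thesis
    unfolding accepts_def tally_edges[OF assms] by (simp only: card_edge_boundary_lessThan)
qed

text \<open>Exploration overwrites only marks 0, and only by 1 or 3. Hence the terminal stays
  chosen, and the mark 2 is free for the final count.\<close>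

lemma guess_start:
  "guess n E L s w s = 3" and guess_ne_2: "guess n E L s w v \<noteq> 2"
proof -
  define I where "I st \<longleftrightarrow> fst st s = 3 \<and> (\<forall>v. fst st v \<noteq> 2)" for st :: "(nat \<Rightarrow> nat) \<times> nat"
  have step: "I (explore n E L q st)" if "I st" for q st
    using that by (auto simp: I_def explore_def frontier_def split: prod.splits)
  have "I (fold (explore n E L) qs st)" if "I st" for qs st
    using that by (induction qs arbitrary: st) (simp_all add: step)
  moreover have "I (start s, w)" by (simp add: I_def start_def)
  ultimately have "I ((sweep (explore n E L) (n * n) ^^ n) (start s, w))"
    unfolding funpow_fold by blast
  then show "guess n E L s w s = 3" "guess n E L s w v \<noteq> 2" by (simp_all add: guess_def I_def)
qed

subsection \<open>Some sequence of decisions finds a solution\<close>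

definition seen :: "nat \<Rightarrow> (nat \<Rightarrow> nat) \<Rightarrow> nat set" where
  "seen n \<sigma> = {v. v < n \<and> \<sigma> v \<noteq> 0}"

definition consistent :: "nat \<Rightarrow> nat set set \<Rightarrow> nat set \<Rightarrow> (nat \<Rightarrow> nat) \<Rightarrow> bool" where
  "consistent n E D \<sigma> \<longleftrightarrow>
     (\<forall>v<n. \<sigma> v \<noteq> 0 \<longrightarrow> (if 2 < \<sigma> v then v \<in> D else v \<in> open_nbhd {..<n} E D))"

lemma finite_seen: "finite (seen n \<sigma>)"
  by (simp add: seen_def)

lemma card_seen_le: "card (seen n \<sigma>) \<le> n"
  using card_mono[of "{..<n}" "seen n \<sigma>"] by (auto simp: seen_def)

lemma card_seen_update:
  assumes "v < n" "\<sigma> v = 0" "0 < c"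
  shows "card (seen n (\<sigma>(v := c))) = Suc (card (seen n \<sigma>))"
proof -
  have "seen n (\<sigma>(v := c)) = insert v (seen n \<sigma>)" "v \<notin> seen n \<sigma>"
    using assms by (auto simp: seen_def)
  then show ?thesis by (simp add: finite_seen)
qed

text \<open>A newly marked vertex is adjacent to a chosen one, which lies in \<open>D\<close>; so if
  it is outside \<open>D\<close>, it is a neighbour of \<open>D\<close>.\<close>

lemma consistent_guided:
  assumes "consistent n E D \<sigma>" "q < n * n"
  shows "consistent n E D (guided n E D q \<sigma>)"
proof (cases "frontier n E q \<sigma>")
  case True
  then have "q div n \<in> D" "{q div n, q mod n} \<in> E"
    using assms pair_bounds[OF assms(2)]
    by (force simp: consistent_def frontier_def)+
  then have "q mod n \<notin> D \<Longrightarrow> q mod n \<in> open_nbhd {..<n} E D"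
    using pair_bounds[OF assms(2)] by (auto simp: open_nbhd_lessThan)
  then show ?thesis using assms(1) by (auto simp: consistent_def guided_def)
qed (use assms in \<open>simp add: guided_def\<close>)

lemma card_seen_consistent:
  assumes "consistent n E D \<sigma>" "finite D"
  shows "card (seen n \<sigma>) \<le> card D + card (open_nbhd {..<n} E D)"
proof -
  have "seen n \<sigma> \<subseteq> D \<union> open_nbhd {..<n} E D"
    using assms(1) by (force simp: seen_def consistent_def split: if_splits)
  moreover have "finite (D \<union> open_nbhd {..<n} E D)"
    using assms(2) by (simp add: open_nbhd_lessThan)
  ultimately have "card (seen n \<sigma>) \<le> card (D \<union> open_nbhd {..<n} E D)" by (rule card_mono[rotated])
  also have "\<dots> \<le> card D + card (open_nbhd {..<n} E D)" by (rule card_Un_le)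
  finally show ?thesis .
qed

text \<open>
  Every decision that is consistent with \<open>D\<close> marks a new vertex of \<open>D\<close> or of its neighbourhood,
  so at most \<open>L\<close> decisions are taken and the digits of a suitable \<open>x\<close> can supply all of them.
\<close>

lemma explore_simulates_guided:
  assumes "finite D" and "\<forall>q\<in>set qs. q < n * n" and "consistent n E D \<sigma>"
    and "card D + card (open_nbhd {..<n} E D) \<le> card (seen n \<sigma>) + l" and "l \<le> L"
  shows "\<exists>y<2 ^ l. fst (fold (explore n E L) qs (\<sigma>, y * 2 ^ (L - l))) = fold (guided n E D) qs \<sigma>"
  using assms(2-)
proof (induction qs arbitrary: \<sigma> l)
  case Nil
  show ?case by (intro exI[of _ 0]) simp
next
  case (Cons q qs)
  show ?case
  proof (cases "frontier n E q \<sigma>")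
    case False
    then show ?thesis using Cons by (simp add: explore_def guided_def)
  next
    case True
    define \<tau> where "\<tau> = guided n E D q \<sigma>"
    have q: "q < n * n" using Cons.prems(1) by simp
    have con: "consistent n E D \<tau>"
      unfolding \<tau>_def by (rule consistent_guided[OF Cons.prems(2) q])
    have c: "card (seen n \<tau>) = Suc (card (seen n \<sigma>))"
      unfolding \<tau>_def guided_def using True pair_bounds(2)[OF q]
      by (auto simp: frontier_def card_seen_update)
    \<comment> \<open>With \<open>l = 0\<close> the marking \<open>\<sigma>\<close> would already
      exhaust the bound on consistent markings, yet \<open>\<tau>\<close> marks one vertex
      more.\<close>
    with card_seen_consistent[OF con assms(1)] Cons.prems(3) obtain l' where l: "l = Suc l'"
      by (cases l) auto
    obtain y where y: "y < 2 ^ l'"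
      "fst (fold (explore n E L) qs (\<tau>, y * 2 ^ (L - l'))) = fold (guided n E D) qs \<tau>"
      using Cons.IH[of \<tau> l'] Cons.prems c con l by auto
    define d where "d = (if q mod n \<in> D then 2 ^ l' else 0 :: nat)"
    have L: "2 ^ (L - l') = 2 * (2 ^ (L - l) :: nat)"
      using Cons.prems(4) l by (simp add: Suc_diff_Suc flip: power_Suc)
    have P: "(2::nat) ^ L = 2 ^ l' * 2 ^ (L - l')"
      using Cons.prems(4) l by (simp flip: power_add)
    have "y * 2 ^ (L - l') < 2 ^ L" unfolding P using y(1) by simp
    then have "explore n E L q (\<sigma>, (d + y) * 2 ^ (L - l)) = (\<tau>, y * 2 ^ (L - l'))"
      using True P L by (auto simp: explore_def d_def \<tau>_def guided_def algebra_simps)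
    moreover have "d + y < 2 ^ l" using y(1) l by (simp add: d_def)
    ultimately show ?thesis using y(2) by (intro exI[of _ "d + y"]) (simp add: \<tau>_def)
  qed
qed

section \<open>Saturation of the guided exploration\<close>

lemma guided_eq_iff: "guided n E D q \<sigma> = \<sigma> \<longleftrightarrow> \<not> frontier n E q \<sigma>"
  by (auto simp: guided_def frontier_def fun_upd_idem_iff)

lemma card_seen_guided:
  assumes "q < n * n" "frontier n E q \<sigma>"
  shows "card (seen n (guided n E D q \<sigma>)) = Suc (card (seen n \<sigma>))"
  using assms pair_bounds(2)[OF assms(1)]
  by (auto simp: frontier_def guided_def card_seen_update)

lemma card_seen_fold_guided_ge:
  assumes "\<forall>q\<in>set qs. q < n * n"
  shows "card (seen n \<sigma>) \<le> card (seen n (fold (guided n E D) qs \<sigma>))"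
  using assms
proof (induction qs arbitrary: \<sigma>)
  case (Cons q qs)
  have "card (seen n \<sigma>) \<le> card (seen n (guided n E D q \<sigma>))"
    using card_seen_guided[of q n E \<sigma> D] guided_eq_iff[of n E D q \<sigma>] Cons.prems
    by (cases "frontier n E q \<sigma>") auto
  also have "\<dots> \<le> card (seen n (fold (guided n E D) qs (guided n E D q \<sigma>)))"
    using Cons by simp
  finally show ?case by simp
qed simp

text \<open>The pairs before the first frontier pair of the list change nothing, so it is still a
  frontier pair when its turn comes, and it marks a new vertex.\<close>

lemma card_seen_fold_guided_gt:
  assumes "\<forall>q\<in>set qs. q < n * n" "\<exists>q\<in>set qs. frontier n E q \<sigma>"
  shows "card (seen n \<sigma>) < card (seen n (fold (guided n E D) qs \<sigma>))"
  using assms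
proof (induction qs)
  case (Cons q qs)
  show ?case
  proof (cases "frontier n E q \<sigma>")
    case True
    have "card (seen n \<sigma>) < card (seen n (guided n E D q \<sigma>))"
      using card_seen_guided[OF _ True] Cons.prems by simp
    also have "\<dots> \<le> card (seen n (fold (guided n E D) qs (guided n E D q \<sigma>)))"
      using Cons.prems by (intro card_seen_fold_guided_ge) simp
    finally show ?thesis by simp
  next
    case False
    then have "guided n E D q \<sigma> = \<sigma>" by (simp add: guided_eq_iff)
    with Cons False show ?thesis by auto
  qed
qed simp

lemma fold_fixpoint: "\<forall>q\<in>set qs. f q st = st \<Longrightarrow> fold f qs st = st"
  by (induction qs) auto

text \<open>Initially one vertex is seen and every sweep from an unsaturated marking adds another.
  Not being saturated after \<open>n\<close> sweeps would thus require more than \<open>n\<close>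
  seen vertices.\<close>

lemma guided_saturates:
  assumes "s < n"
  shows "\<forall>q<n * n. \<not> frontier n E q ((sweep (guided n E D) (n * n) ^^ n) (start s))"
proof -
  let ?\<sigma> = "\<lambda>j. (sweep (guided n E D) (n * n) ^^ j) (start s)"
  have "(\<forall>q<n * n. \<not> frontier n E q (?\<sigma> j)) \<or> j < card (seen n (?\<sigma> j))" for j
  proof (induction j)
    case 0
    have "seen n (start s) = {s}" using assms by (auto simp: seen_def start_def)
    then show ?case by simp
  next
    case (Suc j)
    show ?case
    proof (cases "\<forall>q<n * n. \<not> frontier n E q (?\<sigma> j)")
      case True
      then have "?\<sigma> (Suc j) = ?\<sigma> j"
        by (auto simp: guided_eq_iff intro!: fold_fixpoint)
      with True show ?thesis by metis
    next
      case False
      then have "card (seen n (?\<sigma> j)) < card (seen n (?\<sigma> (Suc j)))"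
        by (auto intro!: card_seen_fold_guided_gt)
      moreover have "j < card (seen n (?\<sigma> j))" using Suc False by simp
      ultimately show ?thesis by linarith
    qed
  qed
  from this[of n] card_seen_le show ?thesis by (meson leD)
qed

text \<open>Take the string that decides by membership in \<open>D\<close>. By saturation each
  neighbour of the chosen set is marked; as it is not chosen, consistency places it in the
  neighbourhood of \<open>D\<close>.\<close>

lemma guess_complete:
  assumes "s < n" "D \<subseteq> {..<n}" "s \<in> D" "card D + card (open_nbhd {..<n} E D) \<le> L"
  obtains w where "w < 2 ^ L" "chosen n (guess n E L s w) \<subseteq> D"
    "open_nbhd {..<n} E (chosen n (guess n E L s w)) \<subseteq> open_nbhd {..<n} E D"
proof -
  define qs where "qs = concat (replicate n (rev [0..<n * n]))"
  have qs: "\<forall>q\<in>set qs. q < n * n" by (auto simp: qs_def)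
  define \<sigma> where "\<sigma> = fold (guided n E D) qs (start s)"
  have con0: "consistent n E D (start s)"
    using assms(3) by (simp add: consistent_def start_def)
  have "finite D" using assms(2) finite_subset by blast
  from explore_simulates_guided[OF this qs con0, of L L] assms(4)
  obtain w where w: "w < 2 ^ L" "guess n E L s w = \<sigma>"
    by (auto simp: guess_def funpow_fold qs_def \<sigma>_def)
  have "consistent n E D (fold (guided n E D) ps \<tau>)"
    if "\<forall>q\<in>set ps. q < n * n" "consistent n E D \<tau>" for ps \<tau>
    using that by (induction ps arbitrary: \<tau>) (auto intro: consistent_guided)
  with qs con0 have con: "consistent n E D \<sigma>" by (simp add: \<sigma>_def)
  then have sub: "chosen n \<sigma> \<subseteq> D"
    by (force simp: consistent_def chosen_def)
  have sat: "\<not> frontier n E q \<sigma>" if "q < n * n" for q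
    using guided_saturates[OF assms(1), of E D] that by (simp add: funpow_fold \<sigma>_def qs_def)
  have "open_nbhd {..<n} E (chosen n \<sigma>) \<subseteq> open_nbhd {..<n} E D"
  proof
    fix v assume "v \<in> open_nbhd {..<n} E (chosen n \<sigma>)"
    then obtain u where uv: "v < n" "v \<notin> chosen n \<sigma>" "u \<in> chosen n \<sigma>" "{u, v} \<in> E"
      by (auto simp: open_nbhd_lessThan)
    then have "u < n" by (simp add: chosen_def)
    with uv sat[of "u * n + v"] pair_index[of u n v] have "\<sigma> v \<noteq> 0"
      by (auto simp: frontier_def chosen_def)
    then show "v \<in> open_nbhd {..<n} E D"
      using con uv(1,2) by (auto simp: consistent_def chosen_def)
  qed
  with that[of w] w sub show ?thesis by simp
qed

section \<open>Correctness of the exhaustive search\<close>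

lemma finite_open_nbhd_lessThan:
  fixes n :: nat
  shows "finite (open_nbhd {..<n} E X)"
  by (simp add: open_nbhd_lessThan)

lemma start_in_chosen: "s < n \<Longrightarrow> s \<in> chosen n (guess n E L s w)"
  using guess_start[of n E L s w] by (simp add: chosen_def)

lemma search_vertices:
  assumes "s < n"
  shows "search n E k t 2 s \<longleftrightarrow> cutting_vertices_terminal {..<n} E s k t"
proof
  assume "search n E k t 2 s"
  then obtain w where "accepts n E k t 2 (guess n E (k + t) s w)" by (auto simp: search_def)
  then have "card (chosen n (guess n E (k + t) s w)) \<le> k"
    "card (open_nbhd {..<n} E (chosen n (guess n E (k + t) s w))) \<le> t"
    by (simp_all add: accepts_vertices guess_ne_2)
  moreover note start_in_chosen[OF assms, of E "k + t" w]
  ultimately show "cutting_vertices_terminal {..<n} E s k t"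
    unfolding cutting_vertices_terminal_def
    by (intro exI[of _ "chosen n (guess n E (k + t) s w)"]) (auto simp: chosen_def)
next
  assume "cutting_vertices_terminal {..<n} E s k t"
  then obtain D where D: "D \<subseteq> {..<n}" "s \<in> D" "card D \<le> k" "card (open_nbhd {..<n} E D) \<le> t"
    by (auto simp: cutting_vertices_terminal_def)
  obtain w where w: "w < 2 ^ (k + t)" "chosen n (guess n E (k + t) s w) \<subseteq> D"
    "open_nbhd {..<n} E (chosen n (guess n E (k + t) s w)) \<subseteq> open_nbhd {..<n} E D"
    using guess_complete[OF assms D(1,2), of E "k + t"] D(3,4) by auto
  have "finite D" using D(1) finite_subset by blast
  then have "card (chosen n (guess n E (k + t) s w)) \<le> k"
    "card (open_nbhd {..<n} E (chosen n (guess n E (k + t) s w))) \<le> t"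
    using w D card_mono finite_open_nbhd_lessThan by (meson le_trans)+
  then show "search n E k t 2 s" using w(1) unfolding search_def
    by (auto simp: accepts_vertices guess_ne_2)
qed

lemma search_edges:
  assumes "s < n"
  shows "search n E k t 1 s \<longleftrightarrow> cutting_vertices_edge_cut_terminal {..<n} E s k t"
proof
  assume "search n E k t 1 s"
  then obtain w where "accepts n E k t 1 (guess n E (k + t) s w)" by (auto simp: search_def)
  then have "card (chosen n (guess n E (k + t) s w)) \<le> k"
    "card (edge_boundary {..<n} E (chosen n (guess n E (k + t) s w))) \<le> t"
    by (simp_all add: accepts_edges[unfolded One_nat_def] guess_ne_2)
  moreover note start_in_chosen[OF assms, of E "k + t" w]
  ultimately show "cutting_vertices_edge_cut_terminal {..<n} E s k t"
    unfolding cutting_vertices_edge_cut_terminal_def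
    by (intro exI[of _ "chosen n (guess n E (k + t) s w)"]) (auto simp: chosen_def)
next
  assume "cutting_vertices_edge_cut_terminal {..<n} E s k t"
  then obtain D where D: "D \<subseteq> {..<n}" "s \<in> D" "card D \<le> k" "card (edge_boundary {..<n} E D) \<le> t"
    by (auto simp: cutting_vertices_edge_cut_terminal_def)
  have fin: "finite (edge_boundary {..<n} E D)"
  proof (rule finite_subset)
    show "edge_boundary {..<n} E D \<subseteq> Pow {..<n}" using D(1) by (auto simp: edge_boundary_def)
  qed simp
  \<comment> \<open>Sending a boundary edge to its end outside \<open>D\<close> covers the
    neighbourhood of \<open>D\<close>. So the neighbourhood has at most \<open>t\<close> vertices
    and \<open>k + t\<close> digits suffice here as well.\<close>
  have "open_nbhd {..<n} E D \<subseteq> (\<lambda>e. the_elem (e - D)) ` edge_boundary {..<n} E D"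
  proof
    fix v assume "v \<in> open_nbhd {..<n} E D"
    then obtain u where uv: "v < n" "v \<notin> D" "u \<in> D" "{u, v} \<in> E"
      by (auto simp: open_nbhd_lessThan)
    then have "{u, v} - D = {v}" by auto
    moreover have "{u, v} \<in> edge_boundary {..<n} E D" using uv by (auto simp: edge_boundary_def)
    ultimately show "v \<in> (\<lambda>e. the_elem (e - D)) ` edge_boundary {..<n} E D"
      by (intro image_eqI[of _ _ "{u, v}"]) simp_all
  qed
  from surj_card_le[OF fin this] D(3,4)
  have "card D + card (open_nbhd {..<n} E D) \<le> k + t" by linarith
  then obtain w where w: "w < 2 ^ (k + t)" "chosen n (guess n E (k + t) s w) \<subseteq> D"
    "open_nbhd {..<n} E (chosen n (guess n E (k + t) s w)) \<subseteq> open_nbhd {..<n} E D"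
    using guess_complete[OF assms D(1,2)] by blast
  \<comment> \<open>The outer end of such an edge lies in the neighbourhood of \<open>D\<close>,
    hence outside \<open>D\<close>, while the inner end lies in \<open>D\<close>.\<close>
  have "edge_boundary {..<n} E (chosen n (guess n E (k + t) s w)) \<subseteq> edge_boundary {..<n} E D"
  proof
    fix e assume "e \<in> edge_boundary {..<n} E (chosen n (guess n E (k + t) s w))"
    then obtain u v where uv: "e = {u, v}" "{u, v} \<in> E" "u \<in> chosen n (guess n E (k + t) s w)"
        "v < n" "v \<notin> chosen n (guess n E (k + t) s w)"
      by (auto simp: edge_boundary_def)
    then have "v \<in> open_nbhd {..<n} E (chosen n (guess n E (k + t) s w))"
      by (auto simp: open_nbhd_lessThan)
    then have "v \<notin> D" using w(3) by (auto simp: open_nbhd_lessThan)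
    then show "e \<in> edge_boundary {..<n} E D" using uv w(2) by (auto simp: edge_boundary_def)
  qed
  moreover have "finite D" using D(1) finite_subset by blast
  ultimately have "card (chosen n (guess n E (k + t) s w)) \<le> k"
    "card (edge_boundary {..<n} E (chosen n (guess n E (k + t) s w))) \<le> t"
    using w(2) D fin card_mono by (meson le_trans)+
  then show "search n E k t 1 s" using w(1) unfolding search_def
    by (auto simp: accepts_edges[unfolded One_nat_def] guess_ne_2)
qed

lemma cutting_vertices_iff_terminal:
  "cutting_vertices {..<n} E k t \<longleftrightarrow> (\<exists>s<n. cutting_vertices_terminal {..<n} E s k t)"
  unfolding cutting_vertices_def cutting_vertices_terminal_def by blast

section \<open>Implementation on the machine\<close>

text \<open>
  Registers: 0 answer, 2 \<open>k\<close>, 3 \<open>t\<close>, 4 \<open>s\<close>, 5 and 8 the constants 1 and 2, 6 address of the adjacency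
  matrix, 7 address of the marking, 9 \<open>2 ^ (k + t)\<close>, 10 decision string, 11 its unused digits,
  12 \<open>card X\<close>, 13 tally, 14 loop counter, 15 to 17 current pair \<open>q\<close>, \<open>q div n\<close>, \<open>q mod n\<close>,
  18 and 19 scratch, 20 \<open>n * n\<close>, 21 \<open>n\<close>.
\<close>

fun block :: "com list \<Rightarrow> com" where
  "block [] = Skip"
| "block [p] = p"
| "block (p # ps) = Seq p (block ps)"

text \<open>Steps to the preceding pair without division: a column 0 is replaced by \<open>n\<close>
  and one is borrowed from the row.\<close>

definition advance_com :: com where
  "advance_com = block [IfNZ 17 Skip (block [Mov 17 21, Sub 16 16 5]), Sub 17 17 5, Sub 15 15 5]"

text \<open>The start is the pair \<open>(n, 0)\<close> of index \<open>n * n\<close>, one past the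
  last valid one, because each round moves to the preceding pair before the body runs.\<close>

definition sweep_com :: "com \<Rightarrow> com" where
  "sweep_com p = Seq (block [Mov 15 20, Mov 16 21, Imm 17 0]) (WhileNZ 15 (Seq advance_com p))"

text \<open>After the string is doubled, \<open>Sub 19 9 11\<close> is non-zero exactly if the
  shifted-out digit is 0. The size of the chosen set is maintained in register 12 along the
  way.\<close>

definition explore_com :: com where
  "explore_com = block [Add 18 6 15, Load 18 18, IfNZ 18 (block
     [Add 18 7 16, Load 18 18, Sub 18 18 8, IfNZ 18 (block
       [Add 18 7 17, Load 19 18, IfNZ 19 Skip (block
         [Add 11 11 11, Sub 19 9 11, IfNZ 19
           (Store 18 5)
           (block [Sub 11 11 9, Imm 19 3, Store 18 19, Add 12 12 5])])]) Skip]) Skip]"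

definition tally_com :: "nat \<Rightarrow> com" where
  "tally_com c = block [Add 18 6 15, Load 18 18, IfNZ 18 (block
     [Add 18 7 16, Load 18 18, Sub 18 18 8, IfNZ 18 (block
       [Add 18 7 17, Load 19 18, Sub 19 19 5, IfNZ 19 Skip (block
         [Imm 19 c, Store 18 19, Add 13 13 5])]) Skip]) Skip]"

text \<open>Register 10 is decremented first, so the surrounding loop tries the strings from
  \<open>2 ^ (k + t) - 1\<close> down to 0. Register 0 is only ever set to 1, so an earlier success
  survives.\<close>

definition trial_com :: "nat \<Rightarrow> com" where
  "trial_com c = block [
     block [Sub 10 10 5, Mov 14 21],
     WhileNZ 14 (block [Sub 14 14 5, Add 18 7 14, Imm 19 0, Store 18 19]),
     block [Add 18 7 4, Imm 19 3, Store 18 19, Imm 12 1, Mov 11 10, Mov 14 21],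
     WhileNZ 14 (Seq (Sub 14 14 5) (sweep_com explore_com)),
     Imm 13 0,
     sweep_com (tally_com c),
     block [Sub 18 12 2, IfNZ 18 Skip (block [Sub 18 13 3, IfNZ 18 Skip (Imm 0 1)])]]"

text \<open>The number \<open>h\<close> is the count of input cells before the matrix. Lacking
  multiplication, \<open>n * n\<close> is obtained by repeated addition and
  \<open>2 ^ (k + t)\<close> by repeated doubling.\<close>

definition load_com :: "nat \<Rightarrow> com" where
  "load_com h = block [
     block [Imm 5 1, Imm 8 2, Imm 6 h, Imm 18 0, Load 21 18, Imm 18 1, Load 2 18, Imm 18 2, Load 3 18,
       Imm 20 0, Mov 14 21],
     WhileNZ 14 (block [Sub 14 14 5, Add 20 20 21]),
     block [Add 7 6 20, Imm 9 1, Add 14 2 3],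
     WhileNZ 14 (block [Sub 14 14 5, Add 9 9 9])]"

definition search_com :: "nat \<Rightarrow> com" where
  "search_com c = Seq (Mov 10 9) (WhileNZ 10 (trial_com c))"

section \<open>Word length and loading of an instance\<close>

locale instance_in_memory =
  fixes n k t h W :: nat and E :: "nat set set"
  assumes width: "k + t + n * n + n + h + 5 \<le> W"
begin

lemma small: "h + n * n + n + 5 < 2 ^ W"
  using less_exp[of W] width by linarith

text \<open>A decision string is doubled before its leading digit is removed, so a word needs room
  for one digit more than \<open>k + t\<close>.\<close>

lemma power_small: "2 ^ (k + t) + 2 ^ (k + t) < (2 ^ W :: nat)"
proof -
  have "(2::nat) ^ (k + t) + 2 ^ (k + t) = 2 ^ Suc (k + t)" by simp
  also have "\<dots> < 2 ^ W" using width by (intro power_strict_increasing) auto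
  finally show ?thesis .
qed

lemma power_W_ge: "5 < (2 ^ W :: nat)"
  using small by linarith

text \<open>Everything that loading sets up and the search leaves alone. The marking begins at
  \<open>h + n * n\<close>, directly behind the matrix, so writing marks does not damage the
  matrix.\<close>

definition env :: "(nat \<Rightarrow> nat) \<Rightarrow> (nat \<Rightarrow> nat) \<Rightarrow> bool" where
  "env r m \<longleftrightarrow> r 2 = k \<and> r 3 = t \<and> r 5 = 1 \<and> r 6 = h \<and> r 7 = h + n * n \<and> r 8 = 2 \<and>
     r 9 = 2 ^ (k + t) \<and> r 20 = n * n \<and> r 21 = n \<and>
     (\<forall>q<n * n. m (h + q) = of_bool ({q div n, q mod n} \<in> E))"

lemma env_cong:
  assumes "env r m" "\<And>x. x \<in> {2, 3, 5, 6, 7, 8, 9, 20, 21} \<Longrightarrow> r' x = r x"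
  shows "env r' m"
  using assms by (simp add: env_def)

lemma runs_load:
  assumes "m 0 = n" "m 1 = k" "m 2 = t" "\<forall>q<n * n. m (h + q) = of_bool ({q div n, q mod n} \<in> E)"
    and "r 0 = 0"
  shows "runs W (load_com h) r m (3 * n + 3 * (k + t) + 16)
    (\<lambda>r' m'. env r' m' \<and> r' 0 = 0 \<and> m' = m)"
proof -
  let ?in = "\<lambda>r m'. r 0 = 0 \<and> r 2 = k \<and> r 3 = t \<and> r 5 = 1 \<and> r 6 = h \<and> r 8 = 2 \<and> r 21 = n \<and> m' = m"
  \<comment> \<open>In \<open>I\<close> and \<open>J\<close> the value so far, combined with what
    the remaining \<open>j\<close> rounds contribute, is constant. This also bounds all intermediate
    values.\<close>
  define I where "I j r m' \<longleftrightarrow> ?in r m' \<and> r 14 = j \<and> r 20 + j * n = n * n"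
    for j and r m' :: "nat \<Rightarrow> nat"
  define J where "J j r m' \<longleftrightarrow> ?in r m' \<and> r 14 = j \<and> r 20 = n * n \<and> r 7 = h + n * n \<and>
    r 9 * 2 ^ j = 2 ^ (k + t)" for j and r m' :: "nat \<Rightarrow> nat"
  let ?c1 = "block [Imm 5 1, Imm 8 2, Imm 6 h, Imm 18 0, Load 21 18, Imm 18 1, Load 2 18, Imm 18 2,
    Load 3 18, Imm 20 0, Mov 14 21]"
  let ?c2 = "block [Sub 14 14 5, Add 20 20 21]"
  let ?c3 = "block [Add 7 6 20, Imm 9 1, Add 14 2 3]"
  let ?c4 = "block [Sub 14 14 5, Add 9 9 9]"
  have kt: "k + t < 2 ^ W" using width less_exp[of W] by linarith
  have 1: "runs W ?c1 r m 11 (I n)"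
    by (rule runs_loop_free) (use assms small in \<open>simp_all add: I_def\<close>)
  have 2: "runs W (WhileNZ 14 ?c2) r m (n * (2 + 1) + 1) (I 0)" if "I n r m" for r m
    using that
  proof (rule runs_WhileNZ[where I = I])
    fix j r m' assume I: "I (Suc j) r m'"
    then have sum: "r 20 + n + j * n = n * n" by (simp add: I_def)
    then have "r 20 + n < 2 ^ W" using small by linarith
    then show "runs W ?c2 r m' 2 (I j)" using I sum
      by (intro runs_loop_free) (simp_all add: I_def)
  qed (simp add: I_def)
  have 3: "runs W ?c3 r m' 3 (J (k + t))" if "I 0 r m'" for r m'
    by (rule runs_loop_free) (use that small kt in \<open>simp_all add: I_def J_def\<close>)
  have 4: "runs W (WhileNZ 14 ?c4) r m' ((k + t) * (2 + 1) + 1) (J 0)" if "J (k + t) r m'" for r m'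
    using that
  proof (rule runs_WhileNZ[where I = J])
    fix j r m' assume J: "J (Suc j) r m'"
    then have prod: "(r 9 + r 9) * 2 ^ j = 2 ^ (k + t)" by (simp add: J_def algebra_simps)
    have "(r 9 + r 9) * 1 \<le> (r 9 + r 9) * 2 ^ j" by (intro mult_le_mono2) simp
    then have "r 9 + r 9 \<le> 2 ^ (k + t)" unfolding prod by (simp only: mult_1_right)
    then have "r 9 + r 9 < 2 ^ W" using power_small by linarith
    then show "runs W ?c4 r m' 2 (J j)" using J prod
      by (intro runs_loop_free) (simp_all add: J_def)
  qed (simp add: J_def)
  have load: "load_com h = Seq ?c1 (Seq (WhileNZ 14 ?c2) (Seq ?c3 (WhileNZ 14 ?c4)))"
    by (simp only: load_com_def block.simps)
  have "runs W (load_com h) r m (11 + ((n * (2 + 1) + 1) + (3 + ((k + t) * (2 + 1) + 1)))) (J 0)"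
    unfolding load by (intro runs_Seq[OF 1] runs_Seq[OF 2] runs_Seq[OF 3] 4)
  then show ?thesis
    by (rule runs_mono) (use assms(4) in \<open>auto simp: J_def env_def\<close>)
qed

end

section \<open>Sweeps, trials and the search on the machine\<close>

locale nonempty_instance_in_memory = instance_in_memory +
  assumes pos: "0 < n"
begin

text \<open>The value 0 beyond the vertices lets \<open>marks m\<close> be equal, as a function, to
  abstract markings such as \<open>start s\<close>.\<close>

definition marks :: "(nat \<Rightarrow> nat) \<Rightarrow> nat \<Rightarrow> nat" where
  "marks m v = (if v < n then m (h + n * n + v) else 0)"

lemma marks_update: "v < n \<Longrightarrow> marks (m(h + n * n + v := c)) = (marks m)(v := c)"
  by (auto simp: marks_def)

lemma marks_eq: "v < n \<Longrightarrow> m (h + n * n + v) = marks m v"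
  by (simp add: marks_def)

lemma env_marks_update: "env r (m(h + n * n + v := c)) = env r m"
  by (simp add: env_def)

text \<open>The invariant \<open>J\<close> may look only at memory and registers below 15, so moving
  to the next pair preserves it. A round costs \<open>B\<close>, 6 steps for the move and one for
  the test.\<close>

lemma runs_sweep:
  assumes body: "\<And>q r m. \<lbrakk>q < n * n; env r m; r 15 = q; r 16 = q div n; r 17 = q mod n; J (Suc q) r m\<rbrakk>
      \<Longrightarrow> runs W p r m B
        (\<lambda>r m. env r m \<and> r 15 = q \<and> r 16 = q div n \<and> r 17 = q mod n \<and> J q r m)"
    and J: "\<And>q r r' m. J q r m \<Longrightarrow> (\<And>x. x < 15 \<Longrightarrow> r' x = r x) \<Longrightarrow> J q r' m"
    and "env r m" "J (n * n) r m"
  shows "runs W (sweep_com p) r m (n * n * (B + 7) + 4) (\<lambda>r m. env r m \<and> J 0 r m)"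
proof -
  \<comment> \<open>The pair is described by a linear equation that the borrow visibly respects;
    \<open>div\<close> and \<open>mod\<close> are recovered from it after each move.\<close>
  define I where "I j r m \<longleftrightarrow> env r m \<and> J j r m \<and> j \<le> n * n \<and> r 15 = j \<and> r 16 * n + r 17 = j \<and> r 17 < n"
    for j r m
  have init: "runs W (block [Mov 15 20, Mov 16 21, Imm 17 0]) r m 3 (I (n * n))"
  proof (rule runs_loop_free)
    let ?st = "effect (block [Mov 15 20, Mov 16 21, Imm 17 0]) (r, m)"
    have "r 20 = n * n" "r 21 = n" using assms(3) by (simp_all add: env_def)
    then have r: "fst ?st = r(15 := n * n, 16 := n, 17 := 0)" "snd ?st = m" by simp_all
    have "J (n * n) (fst ?st) m" using assms(4) by (rule J) (simp add: r)
    moreover have "env (fst ?st) m" using assms(3) by (rule env_cong) (auto simp: r)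
    ultimately show "I (n * n) (fst ?st) (snd ?st)" using pos unfolding I_def r by simp
  qed (use power_W_ge in simp_all)
  have step: "runs W (Seq advance_com p) r m (6 + B) (I q)" if I: "I (Suc q) r m" for q r m
  proof (rule runs_Seq)
    let ?Q = "\<lambda>r m. env r m \<and> J (Suc q) r m \<and> q < n * n \<and> r 15 = q \<and> r 16 = q div n \<and> r 17 = q mod n"
    show "runs W advance_com r m 6 ?Q"
    proof (rule runs_loop_free)
      define a where "a = (if r 17 = 0 then r 16 - 1 else r 16)"
      define b where "b = (if r 17 = 0 then n - 1 else r 17 - 1)"
      let ?st = "effect advance_com (r, m)"
      have regs: "r 15 = Suc q" "r 16 * n + r 17 = Suc q" "r 17 < n" "r 5 = 1" "r 21 = n"
        using I by (simp_all add: I_def env_def)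
      then have r: "fst ?st = r(15 := q, 16 := a, 17 := b)" "snd ?st = m"
        by (auto simp: advance_com_def a_def b_def fun_eq_iff)
      have "a * n + b = q \<and> b < n"
      proof (cases "r 17 = 0")
        case True
        then have "r 16 * n = Suc q" using regs(2) by simp
        then obtain i where "r 16 = Suc i" by (cases "r 16") auto
        with True regs(2) pos show ?thesis by (simp add: a_def b_def)
      qed (use regs in \<open>simp add: a_def b_def\<close>)
      then have "a = q div n" "b = q mod n" by auto
      moreover have "J (Suc q) (fst ?st) m"
        by (rule J[of _ r]) (use I in \<open>simp_all add: I_def r\<close>)
      moreover have "env (fst ?st) m"
        by (rule env_cong[of r]) (use I in \<open>auto simp add: I_def r\<close>)
      ultimately show "?Q (fst ?st) (snd ?st)" using I by (simp add: I_def r)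
    qed (simp_all add: advance_com_def)
    show "runs W p r m B (I q)" if Q: "?Q r m" for r m
    proof (rule runs_mono[OF body[of q r m] order_refl])
      fix r' m' assume 1: "env r' m' \<and> r' 15 = q \<and> r' 16 = q div n \<and> r' 17 = q mod n \<and> J q r' m'"
      have "r' 16 * n + r' 17 = q" using 1 by simp
      with 1 Q pos show "I q r' m'" by (simp add: I_def)
    qed (use Q in auto)
  qed
  have loop: "runs W (WhileNZ 15 (Seq advance_com p)) r m (n * n * (6 + B + 1) + 1) (I 0)"
    if "I (n * n) r m" for r m
    using that by (rule runs_WhileNZ[where I = I]) (erule step | simp add: I_def)+
  show ?thesis unfolding sweep_com_def
    by (rule runs_mono[OF runs_Seq[OF init loop]]) (auto simp: I_def algebra_simps)
qed

text \<open>The invariant looks ahead: sweeping the pairs below \<open>q\<close> from the present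
  state yields the fixed result \<open>fin\<close>. One run of the body then peels one function off
  the fold.\<close>

definition explore_inv ::
  "nat \<Rightarrow> nat \<Rightarrow> nat \<Rightarrow> nat \<Rightarrow> (nat \<Rightarrow> nat) \<times> nat
    \<Rightarrow> nat \<Rightarrow> (nat \<Rightarrow> nat) \<Rightarrow> (nat \<Rightarrow> nat) \<Rightarrow> bool" where
  "explore_inv a s w j fin q r m \<longleftrightarrow> r 0 = a \<and> r 4 = s \<and> r 10 = w \<and> r 14 = j \<and>
     sweep (explore n E (k + t)) q (marks m, r 11) = fin \<and>
     r 12 = card (chosen n (marks m)) \<and> r 11 < 2 ^ (k + t)"

text \<open>Looks ahead like \<open>explore_inv\<close>; the last conjunct keeps the tally within
  the word length.\<close>

definition tally_inv ::
  "nat \<Rightarrow> nat \<Rightarrow> nat \<Rightarrow> nat \<Rightarrow> nat \<Rightarrow> (nat \<Rightarrow> nat) \<times> nat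
    \<Rightarrow> nat \<Rightarrow> (nat \<Rightarrow> nat) \<Rightarrow> (nat \<Rightarrow> nat) \<Rightarrow> bool" where
  "tally_inv c a s w x fin q r m \<longleftrightarrow> r 0 = a \<and> r 4 = s \<and> r 10 = w \<and> r 12 = x \<and>
     sweep (tally n E c) q (marks m, r 13) = fin \<and> r 13 + q \<le> n * n"

lemma runs_explore:
  assumes q: "q < n * n" and r: "env r m" "r 15 = q" "r 16 = q div n" "r 17 = q mod n"
    and I: "explore_inv a s w j fin (Suc q) r m"
  shows "runs W explore_com r m 30
    (\<lambda>r m. env r m \<and> r 15 = q \<and> r 16 = q div n \<and> r 17 = q mod n \<and> explore_inv a s w j fin q r m)"
proof (rule runs_loop_free)
  note b = pair_bounds[OF q]
  note env = r(1)[unfolded env_def]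
  have adj: "m (h + q) = of_bool ({q div n, q mod n} \<in> E)"
    using env q by (elim conjE allE[of _ q]) simp
  have addr: "h + q < 2 ^ W" "h + n * n + q div n < 2 ^ W" "h + n * n + q mod n < 2 ^ W"
    using small q b by linarith+
  \<comment> \<open>Rules out an overflow when register 12 is incremented.\<close>
  have card: "card (chosen n (marks m)) \<le> n"
    using card_mono[of "{..<n}" "chosen n (marks m)"] by (auto simp: chosen_def)
  have card': "card (chosen n ((marks m)(q mod n := Suc 0))) = card (chosen n (marks m))"
    "card (chosen n ((marks m)(q mod n := 3))) = Suc (card (chosen n (marks m)))"
    if "marks m (q mod n) = 0"
  proof -
    have "chosen n ((marks m)(q mod n := Suc 0)) = chosen n (marks m)"
      using that by (auto simp: chosen_def)
    then show "card (chosen n ((marks m)(q mod n := Suc 0))) = card (chosen n (marks m))" by simp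
    have "chosen n ((marks m)(q mod n := 3)) = insert (q mod n) (chosen n (marks m))"
      "q mod n \<notin> chosen n (marks m)" "finite (chosen n (marks m))"
      using that b by (auto simp: chosen_def)
    then show "card (chosen n ((marks m)(q mod n := 3))) = Suc (card (chosen n (marks m)))" by simp
  qed
  show "loop_free explore_com" "steps explore_com \<le> 30" by (simp_all add: explore_com_def)
  show "fits W explore_com (r, m)"
    using env r(2-) I q addr small power_small card
    by (simp add: explore_com_def explore_inv_def)
  let ?st = "effect explore_com (r, m)"
  show "env (fst ?st) (snd ?st) \<and> fst ?st 15 = q \<and> fst ?st 16 = q div n \<and> fst ?st 17 = q mod n \<and>
      explore_inv a s w j fin q (fst ?st) (snd ?st)"
  proof (cases "frontier n E q (marks m)")
    case True
    then have zero: "marks m (q mod n) = 0" by (simp add: frontier_def)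
    show ?thesis
    proof (cases "2 * r 11 < 2 ^ (k + t)")
      case lt: True
      define r' where "r' = r(18 := h + n * n + q mod n, 11 := 2 * r 11, 19 := 2 ^ (k + t) - 2 * r 11)"
      have st: "?st = (r', m(h + n * n + q mod n := 1))"
        using env r(2-) adj True lt b
        by (simp add: explore_com_def frontier_def marks_eq fun_eq_iff r'_def mult_2)
      have "env r' m" using r(1) by (rule env_cong) (auto simp: r'_def)
      then show ?thesis unfolding st using I r True lt b card'(1)[OF zero]
        by (simp add: env_marks_update marks_update explore_inv_def r'_def explore_def)
    next
      case ge: False
      define r' where "r' = r(18 := h + n * n + q mod n, 11 := 2 * r 11 - 2 ^ (k + t), 19 := 3,
        12 := Suc (r 12))"
      have st: "?st = (r', m(h + n * n + q mod n := 3))"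
        using env r(2-) adj True ge b
        by (simp add: explore_com_def frontier_def marks_eq fun_eq_iff r'_def mult_2)
      have "env r' m" using r(1) by (rule env_cong) (auto simp: r'_def)
      moreover have "2 * r 11 - 2 ^ (k + t) < 2 ^ (k + t)"
        using I ge unfolding explore_inv_def by linarith
      ultimately show ?thesis unfolding st using I r True ge b card'(2)[OF zero]
        by (simp add: env_marks_update marks_update explore_inv_def r'_def explore_def)
    qed
  next
    case False
    then have st: "snd ?st = m" "\<And>x. x \<notin> {18, 19} \<Longrightarrow> fst ?st x = r x"
      using env r(2-) adj b by (auto simp: explore_com_def frontier_def marks_eq)
    have "env (fst ?st) m" using r(1) by (rule env_cong) (auto intro: st(2))
    then show ?thesis using I r False
      by (simp add: st explore_inv_def explore_def)
  qed
qed

lemma runs_tally: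
  assumes c: "0 < c" "c \<le> 2"
    and q: "q < n * n" and r: "env r m" "r 15 = q" "r 16 = q div n" "r 17 = q mod n"
    and I: "tally_inv c a s w x fin (Suc q) r m"
  shows "runs W (tally_com c) r m 30
    (\<lambda>r m. env r m \<and> r 15 = q \<and> r 16 = q div n \<and> r 17 = q mod n \<and> tally_inv c a s w x fin q r m)"
proof (rule runs_loop_free)
  note b = pair_bounds[OF q]
  note env = r(1)[unfolded env_def]
  have adj: "m (h + q) = of_bool ({q div n, q mod n} \<in> E)"
    using env q by (elim conjE allE[of _ q]) simp
  have addr: "h + q < 2 ^ W" "h + n * n + q div n < 2 ^ W" "h + n * n + q mod n < 2 ^ W"
    using small q b by linarith+
  show "loop_free (tally_com c)" "steps (tally_com c) \<le> 30" by (simp_all add: tally_com_def)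
  show "fits W (tally_com c) (r, m)"
    using env r(2-) I q addr small power_small c
    by (simp add: tally_com_def tally_inv_def)
  let ?st = "effect (tally_com c) (r, m)"
  let ?act = "{q div n, q mod n} \<in> E \<and> 2 < marks m (q div n) \<and> marks m (q mod n) \<le> 1"
  show "env (fst ?st) (snd ?st) \<and> fst ?st 15 = q \<and> fst ?st 16 = q div n \<and> fst ?st 17 = q mod n \<and>
      tally_inv c a s w x fin q (fst ?st) (snd ?st)"
  proof (cases ?act)
    case True
    define r' where "r' = r(18 := h + n * n + q mod n, 19 := c, 13 := Suc (r 13))"
    have st: "?st = (r', m(h + n * n + q mod n := c))"
      using env r(2-) adj True b
      by (simp add: tally_com_def marks_eq fun_eq_iff r'_def)
    have "env r' m" using r(1) by (rule env_cong) (auto simp: r'_def)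
    then show ?thesis unfolding st using I r True b
      by (simp add: env_marks_update marks_update tally_inv_def r'_def tally_def)
  next
    case False
    then have st: "snd ?st = m" "\<And>x. x \<notin> {18, 19} \<Longrightarrow> fst ?st x = r x"
      using env r(2-) adj b by (auto simp: tally_com_def marks_eq)
    have "env (fst ?st) m" using r(1) by (rule env_cong) (auto intro: st(2))
    then show ?thesis using I r False
      by (auto simp: st tally_inv_def tally_def)
  qed
qed

lemma runs_explore_sweep:
  assumes "env r m" "explore_inv a s w j fin (n * n) r m"
  shows "runs W (sweep_com explore_com) r m (37 * (n * n) + 4)
    (\<lambda>r m. env r m \<and> explore_inv a s w j fin 0 r m)"
proof -
  have "runs W (sweep_com explore_com) r m (n * n * (30 + 7) + 4)
      (\<lambda>r m. env r m \<and> explore_inv a s w j fin 0 r m)"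
  proof (rule runs_sweep[where J = "explore_inv a s w j fin"])
    show "runs W explore_com r m 30
        (\<lambda>r m. env r m \<and> r 15 = q \<and> r 16 = q div n \<and> r 17 = q mod n \<and> explore_inv a s w j fin q r m)"
      if "q < n * n" "env r m" "r 15 = q" "r 16 = q div n" "r 17 = q mod n"
        "explore_inv a s w j fin (Suc q) r m" for q r m
      using that by (rule runs_explore)

    show "explore_inv a s w j fin q r' m" if "explore_inv a s w j fin q r m"
      "\<And>x. x < 15 \<Longrightarrow> r' x = r x" for q r r' m
      using that(1) by (simp add: explore_inv_def that(2))
  qed (use assms in \<open>simp_all only:\<close>)
  then show ?thesis by (simp add: mult.commute)
qed

lemma runs_tally_sweep:
  assumes "0 < c" "c \<le> 2" "env r m" "tally_inv c a s w x fin (n * n) r m"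
  shows "runs W (sweep_com (tally_com c)) r m (37 * (n * n) + 4)
    (\<lambda>r m. env r m \<and> tally_inv c a s w x fin 0 r m)"
proof -
  have "runs W (sweep_com (tally_com c)) r m (n * n * (30 + 7) + 4)
      (\<lambda>r m. env r m \<and> tally_inv c a s w x fin 0 r m)"
  proof (rule runs_sweep[where J = "tally_inv c a s w x fin"])
    show "runs W (tally_com c) r m 30
        (\<lambda>r m. env r m \<and> r 15 = q \<and> r 16 = q div n \<and> r 17 = q mod n \<and> tally_inv c a s w x fin q r m)"
      if "q < n * n" "env r m" "r 15 = q" "r 16 = q div n" "r 17 = q mod n"
        "tally_inv c a s w x fin (Suc q) r m" for q r m
      using assms(1,2) that by (rule runs_tally)

    show "tally_inv c a s w x fin q r' m" if "tally_inv c a s w x fin q r m"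
      "\<And>x. x < 15 \<Longrightarrow> r' x = r x" for q r r' m
      using that(1) by (simp add: tally_inv_def that(2))
  qed (use assms in \<open>simp_all only:\<close>)
  then show ?thesis by (simp add: mult.commute)
qed


lemma card_chosen_start: "s < n \<Longrightarrow> card (chosen n (start s)) = 1"
proof -
  assume "s < n"
  then have "chosen n (start s) = {s}" by (auto simp: chosen_def start_def)
  then show ?thesis by simp
qed

text \<open>Erases the marking left by the previous trial, from the top down. At
  \<open>j = n\<close> the invariant holds because \<open>marks\<close> is 0 beyond the
  vertices.\<close>

lemma runs_clear:
  assumes "env r m" "r 0 = a" "r 4 = s" "r 10 = w" "r 14 = n"
  shows "runs W (WhileNZ 14 (block [Sub 14 14 5, Add 18 7 14, Imm 19 0, Store 18 19])) r m
    (5 * n + 1) (\<lambda>r m. env r m \<and> r 0 = a \<and> r 4 = s \<and> r 10 = w \<and> marks m = (\<lambda>_. 0))"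
proof -
  define I where "I j r m \<longleftrightarrow> env r m \<and> r 0 = a \<and> r 4 = s \<and> r 10 = w \<and> r 14 = j \<and> j \<le> n \<and>
    (\<forall>v. j \<le> v \<longrightarrow> marks m v = 0)" for j r m
  let ?p = "block [Sub 14 14 5, Add 18 7 14, Imm 19 0, Store 18 19]"
  have step: "runs W ?p r m 4 (I j)" if I: "I (Suc j) r m" for j r m
  proof (rule runs_loop_free)
    have regs: "r 5 = 1" "r 7 = h + n * n" "r 14 = Suc j" "j < n"
      using I by (simp_all add: I_def env_def)
    show "fits W ?p (r, m)" using regs small by simp
    define r' where "r' = r(14 := j, 18 := h + n * n + j, 19 := 0)"
    have st: "effect ?p (r, m) = (r', m(h + n * n + j := 0))" using regs by (simp add: r'_def)
    have "env r' m" by (rule env_cong[of r]) (use I in \<open>auto simp: I_def r'_def\<close>)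
    moreover have "((marks m)(j := 0)) v = 0" if "j \<le> v" for v
      using I that by (cases "v = j") (auto simp: I_def)
    ultimately show "I j (fst (effect ?p (r, m))) (snd (effect ?p (r, m)))"
      unfolding st using I regs(4)
      by (simp add: I_def env_marks_update marks_update r'_def del: fun_upd_apply)
        (simp add: I_def r'_def)
  qed simp_all
  have "I n r m" using assms by (auto simp: I_def marks_def)
  then have "runs W (WhileNZ 14 ?p) r m (n * (4 + 1) + 1) (I 0)"
    by (rule runs_WhileNZ[where I = I]) (erule step | simp add: I_def)+
  then show ?thesis by (rule runs_mono) (auto simp: I_def)
qed

lemma runs_passes:
  assumes "s < n" "w < 2 ^ (k + t)" "env r m" "r 0 = a" "r 4 = s" "r 10 = w" "r 11 = w"
    "r 12 = 1" "r 14 = n" "marks m = start s"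
  shows "runs W (WhileNZ 14 (Seq (Sub 14 14 5) (sweep_com explore_com))) r m
    (n * (37 * (n * n) + 6) + 1)
    (\<lambda>r m. env r m \<and> r 0 = a \<and> r 4 = s \<and> r 10 = w \<and> marks m = guess n E (k + t) s w \<and>
      r 12 = card (chosen n (marks m)))"
proof -
  let ?f = "sweep (explore n E (k + t)) (n * n)"
  define fin where "fin = (?f ^^ n) (start s, w)"
  define I where "I j r m \<longleftrightarrow> env r m \<and> r 0 = a \<and> r 4 = s \<and> r 10 = w \<and> r 14 = j \<and>
    (?f ^^ j) (marks m, r 11) = fin \<and> r 12 = card (chosen n (marks m)) \<and> r 11 < 2 ^ (k + t)"
    for j r m
  have step: "runs W (Seq (Sub 14 14 5) (sweep_com explore_com)) r m (1 + (37 * (n * n) + 4)) (I j)"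
    if I: "I (Suc j) r m" for j r m
  proof (rule runs_Seq)
    let ?Q = "\<lambda>r m. env r m \<and> (?f ^^ Suc j) (marks m, r 11) = fin \<and>
      explore_inv a s w j (?f (marks m, r 11)) (n * n) r m"
    show "runs W (Sub 14 14 5) r m 1 ?Q"
    proof (rule runs_loop_free)
      have "r 14 = Suc j" "r 5 = 1" using I by (simp_all add: I_def env_def)
      then have st: "effect (Sub 14 14 5) (r, m) = (r(14 := j), m)" by simp
      have "env (r(14 := j)) m" by (rule env_cong[of r]) (use I in \<open>auto simp: I_def\<close>)
      then show "?Q (fst (effect (Sub 14 14 5) (r, m))) (snd (effect (Sub 14 14 5) (r, m)))"
        unfolding st using I by (simp add: I_def explore_inv_def)
    qed simp_all
    show "runs W (sweep_com explore_com) r m (37 * (n * n) + 4) (I j)" if Q: "?Q r m" for r m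
    proof (rule runs_mono[OF runs_explore_sweep order_refl])
      fix r' m' assume 1: "env r' m' \<and> explore_inv a s w j (?f (marks m, r 11)) 0 r' m'"
      then have "(marks m', r' 11) = ?f (marks m, r 11)" by (simp add: explore_inv_def)
      moreover have "(?f ^^ j) (?f (marks m, r 11)) = fin" using Q by (simp add: funpow_swap1)
      ultimately have "(?f ^^ j) (marks m', r' 11) = fin" by simp
      with 1 show "I j r' m'" by (simp add: I_def explore_inv_def)
    qed (use Q in auto)
  qed
  have "I n r m"
    using assms card_chosen_start[of s] by (simp add: I_def fin_def)
  then have "runs W (WhileNZ 14 (Seq (Sub 14 14 5) (sweep_com explore_com))) r m
      (n * (1 + (37 * (n * n) + 4) + 1) + 1) (I 0)"
    by (rule runs_WhileNZ[where I = I]) (erule step | simp add: I_def)+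
  then show ?thesis
    by (rule runs_mono) (auto simp: I_def fin_def guess_def dest: arg_cong[of _ _ fst])
qed

lemma runs_trial:
  assumes "s < n" "w < 2 ^ (k + t)" "0 < c" "c \<le> 2"
    and "env r m" "r 0 = a" "r 4 = s" "r 10 = Suc w"
  shows "runs W (trial_com c) r m (110 * (n * n * n)) (\<lambda>r m. env r m \<and> r 4 = s \<and> r 10 = w \<and>
    r 0 = (if accepts n E k t c (guess n E (k + t) s w) then 1 else a))"
proof -
  let ?g = "guess n E (k + t) s w"
  let ?fin = "sweep (tally n E c) (n * n) (?g, 0)"
  let ?P1 = "\<lambda>r m. env r m \<and> r 0 = a \<and> r 4 = s \<and> r 10 = w \<and> r 14 = n"
  let ?P2 = "\<lambda>r m. env r m \<and> r 0 = a \<and> r 4 = s \<and> r 10 = w \<and> marks m = (\<lambda>_. 0)"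
  let ?P3 = "\<lambda>r m. env r m \<and> r 0 = a \<and> r 4 = s \<and> r 10 = w \<and> r 11 = w \<and> r 12 = 1 \<and> r 14 = n \<and>
    marks m = start s"
  let ?P4 = "\<lambda>r m. env r m \<and> r 0 = a \<and> r 4 = s \<and> r 10 = w \<and> marks m = ?g \<and>
      r 12 = card (chosen n (marks m))"
  let ?P5 = "\<lambda>r m. env r m \<and> tally_inv c a s w (card (chosen n ?g)) ?fin (n * n) r m"
  let ?P6 = "\<lambda>r m. env r m \<and> tally_inv c a s w (card (chosen n ?g)) ?fin 0 r m"
  let ?P7 = "\<lambda>r m. env r m \<and> r 4 = s \<and> r 10 = w \<and> r 0 = (if accepts n E k t c ?g then 1 else a)"
  let ?c1 = "block [Sub 10 10 5, Mov 14 21]"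
  have 1: "runs W ?c1 r m 2 ?P1"
  proof (rule runs_loop_free)
    have "r 5 = 1" "r 21 = n" using assms by (simp_all add: env_def)
    then have st: "effect ?c1 (r, m) = (r(10 := w, 14 := n), m)" using assms by simp
    have "env (r(10 := w, 14 := n)) m" by (rule env_cong[of r]) (use assms in auto)
    then show "?P1 (fst (effect ?c1 (r, m))) (snd (effect ?c1 (r, m)))"
      unfolding st using assms by simp
  qed simp_all
  let ?c3 = "block [Add 18 7 4, Imm 19 3, Store 18 19, Imm 12 1, Mov 11 10, Mov 14 21]"
  let ?c2 = "WhileNZ 14 (block [Sub 14 14 5, Add 18 7 14, Imm 19 0, Store 18 19])"
  let ?c4 = "WhileNZ 14 (Seq (Sub 14 14 5) (sweep_com explore_com))"
  have 3: "runs W ?c3 r m 6 ?P3" if P: "?P2 r m" for r m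
  proof (rule runs_loop_free)
    have regs: "r 4 = s" "r 7 = h + n * n" "r 10 = w" "r 21 = n" using P by (simp_all add: env_def)
    define r' where "r' = r(18 := h + n * n + s, 19 := 3, 12 := 1, 11 := w, 14 := n)"
    have st: "effect ?c3 (r, m) = (r', m(h + n * n + s := 3))"
      using regs by (simp add: r'_def)
    show "fits W ?c3 (r, m)" using regs small assms(1) by simp
    have "env r' m" by (rule env_cong[of r]) (use P in \<open>auto simp: r'_def\<close>)
    then show "?P3 (fst (effect ?c3 (r, m))) (snd (effect ?c3 (r, m)))"
      unfolding st using P assms(1)
      by (simp add: env_marks_update marks_update start_def r'_def)
  qed simp_all
  have 5: "runs W (Imm 13 0) r m 1 ?P5" if P: "?P4 r m" for r m
  proof (rule runs_loop_free)
    have "env (r(13 := 0)) m" by (rule env_cong[of r]) (use P in auto)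
    then show "?P5 (fst (effect (Imm 13 0) (r, m))) (snd (effect (Imm 13 0) (r, m)))"
      using P by (simp add: tally_inv_def)
  qed simp_all
  let ?c7 = "block [Sub 18 12 2, IfNZ 18 Skip (block [Sub 18 13 3, IfNZ 18 Skip (Imm 0 1)])]"
  have 7: "runs W ?c7 r m 7 ?P7" if P: "?P6 r m" for r m
  proof (rule runs_loop_free)
    have fin: "(marks m, r 13) = ?fin" using P by (simp add: tally_inv_def)
    have regs: "r 0 = a" "r 2 = k" "r 3 = t" "r 4 = s" "r 10 = w"
      "r 12 = card (chosen n ?g)" "r 13 = snd ?fin"
      using P by (simp_all add: env_def tally_inv_def flip: fin)
    have acc: "accepts n E k t c ?g \<longleftrightarrow> r 12 \<le> k \<and> r 13 \<le> t"
      by (simp add: accepts_def regs)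
    have st: "snd (effect ?c7 (r, m)) = m" "\<And>x. x \<notin> {0, 18} \<Longrightarrow> fst (effect ?c7 (r, m)) x = r x"
      "fst (effect ?c7 (r, m)) 0 = (if accepts n E k t c ?g then 1 else a)"
      unfolding acc using regs(1-3) by auto
    have "env (fst (effect ?c7 (r, m))) m"
      by (rule env_cong[of r]) (use P in \<open>auto intro: st(2)\<close>)
    then show "?P7 (fst (effect ?c7 (r, m))) (snd (effect ?c7 (r, m)))"
      unfolding st(1,3) using regs(4,5) st(2)[of 4] st(2)[of 10] by simp
  qed (use power_W_ge in simp_all)
  have trial: "trial_com c = Seq ?c1 (Seq ?c2 (Seq ?c3 (Seq ?c4 (Seq (Imm 13 0)
      (Seq (sweep_com (tally_com c)) ?c7)))))"
    by (simp only: trial_com_def block.simps)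
  have "runs W (trial_com c) r m (2 + ((5 * n + 1) + (6 + ((n * (37 * (n * n) + 6) + 1) +
      (1 + ((37 * (n * n) + 4) + 7)))))) ?P7"
    unfolding trial
  proof (intro runs_Seq)
    show "runs W ?c1 r m 2 ?P1" by (fact 1)
  next
    fix r m assume "?P1 r m"
    then show "runs W ?c2 r m (5 * n + 1) ?P2" by (intro runs_clear) auto
  next
    fix r m assume "?P2 r m"
    then show "runs W ?c3 r m 6 ?P3" by (rule 3)
  next
    fix r m assume "?P3 r m"
    then show "runs W ?c4 r m (n * (37 * (n * n) + 6) + 1) ?P4" using assms(1,2) by (intro runs_passes) auto
  next
    fix r m assume "?P4 r m"
    then show "runs W (Imm 13 0) r m 1 ?P5" by (rule 5)
  next
    fix r m assume "?P5 r m"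
    then show "runs W (sweep_com (tally_com c)) r m (37 * (n * n) + 4) ?P6"
      using assms(3,4) by (intro runs_tally_sweep) auto
  next
    fix r m assume "?P6 r m"
    then show "runs W ?c7 r m 7 ?P7" by (rule 7)
  qed
  then show ?thesis
  proof (rule runs_mono)
    \<comment> \<open>Bounding lower powers of \<open>n\<close> by the cube, the coefficients add up
      to 37 + 37 + 11 + 22 = 107.\<close>
    have "1 \<le> n" using pos by simp
    then have "n \<le> n * n" "n * n \<le> n * (n * n)"
      using mult_le_mono1[of 1 n "n * n"] by simp_all
    with \<open>1 \<le> n\<close>
    show "2 + ((5 * n + 1) + (6 + ((n * (37 * (n * n) + 6) + 1) +
      (1 + ((37 * (n * n) + 4) + 7))))) \<le> 110 * (n * n * n)"
      unfolding distrib_left mult.assoc mult.left_commute[of n 37] mult.commute[of n 6] by linarith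
  qed
qed

text \<open>As the strings count down, register 0 reports in round \<open>j\<close> whether some
  string from \<open>j\<close> on was accepted, or else keeps its old value
  \<open>a\<close>.\<close>

lemma runs_search:
  assumes "s < n" "0 < c" "c \<le> 2" "env r m" "r 0 = a" "r 4 = s"
  shows "runs W (search_com c) r m (113 * 2 ^ (k + t) * (n * n * n))
    (\<lambda>r m. env r m \<and> r 4 = s \<and> r 0 = (if search n E k t c s then 1 else a))"
proof -
  let ?acc = "\<lambda>w. accepts n E k t c (guess n E (k + t) s w)"
  define I where "I j r m \<longleftrightarrow> env r m \<and> r 4 = s \<and> r 10 = j \<and> j \<le> 2 ^ (k + t) \<and>
    r 0 = (if \<exists>w<2 ^ (k + t). j \<le> w \<and> ?acc w then 1 else a)" for j r m
  have init: "runs W (Mov 10 9) r m 1 (I (2 ^ (k + t)))"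
  proof (rule runs_loop_free)
    have "r 9 = 2 ^ (k + t)" using assms by (simp add: env_def)
    then have st: "effect (Mov 10 9) (r, m) = (r(10 := 2 ^ (k + t)), m)" by simp
    have "env (r(10 := 2 ^ (k + t))) m" by (rule env_cong[of r]) (use assms in auto)
    then show "I (2 ^ (k + t)) (fst (effect (Mov 10 9) (r, m))) (snd (effect (Mov 10 9) (r, m)))"
      unfolding st using assms by (auto simp: I_def)
  qed simp_all
  have step: "runs W (trial_com c) r m (110 * (n * n * n)) (I j)" if I: "I (Suc j) r m" for j r m
  proof (rule runs_mono[OF runs_trial[of s j c r m "r 0"] order_refl])
    fix r' m' assume 1: "env r' m' \<and> r' 4 = s \<and> r' 10 = j \<and> r' 0 = (if ?acc j then 1 else r 0)"
    have j: "j < 2 ^ (k + t)" using I by (simp add: I_def)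
    have "(\<exists>w<2 ^ (k + t). j \<le> w \<and> ?acc w) \<longleftrightarrow> ?acc j \<or> (\<exists>w<2 ^ (k + t). Suc j \<le> w \<and> ?acc w)"
      using j by (auto simp: Suc_le_eq order_le_less)
    moreover have "r 0 = (if \<exists>w<2 ^ (k + t). Suc j \<le> w \<and> ?acc w then 1 else a)"
      using I by (simp only: I_def)
    ultimately show "I j r' m'" using 1 j by (simp only: I_def) auto
  qed (use I assms in \<open>auto simp: I_def\<close>)
  have loop: "runs W (WhileNZ 10 (trial_com c)) r m (2 ^ (k + t) * (110 * (n * n * n) + 1) + 1) (I 0)"
    if "I (2 ^ (k + t)) r m" for r m
    using that by (rule runs_WhileNZ[where I = I]) (erule step | simp add: I_def)+
  show ?thesis unfolding search_com_def
  proof (rule runs_mono[OF runs_Seq[OF init loop]])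
    \<comment> \<open>The constant is 110 for a trial, 1 for the loop test and 2 for the two single
      steps outside.\<close>
    have "1 \<le> n * n * n" "1 \<le> (2::nat) ^ (k + t)" using pos by simp_all
    then have "2 ^ (k + t) * 1 \<le> 2 ^ (k + t) * (n * n * n)" "1 \<le> 2 ^ (k + t) * (n * n * n)"
      by (simp_all only: mult_le_mono2) (use pos in simp)
    then show "1 + (2 ^ (k + t) * (110 * (n * n * n) + 1) + 1) \<le> 113 * 2 ^ (k + t) * (n * n * n)"
      unfolding distrib_left mult.left_commute[of _ 110] mult.assoc[of 113] by linarith
  qed (auto simp: I_def search_def)
qed

end

section \<open>The complete programs\<close>

definition search_all_com :: com where
  "search_all_com = Seq (load_com 3)
     (Seq (Mov 4 21) (WhileNZ 4 (Seq (Sub 4 4 5) (search_com 2))))"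

definition search_terminal_com :: "nat \<Rightarrow> com" where
  "search_terminal_com c = Seq (load_com 4) (Seq (block [Imm 18 3, Load 4 18]) (search_com c))"

context instance_in_memory
begin

text \<open>Register 4 is both loop counter and terminal, running from \<open>n - 1\<close> down to
  0. The inner search preserves it and never resets register 0, so the answers accumulate as a
  disjunction.\<close>

lemma runs_search_all:
  assumes "h = 3" "m 0 = n" "m 1 = k" "m 2 = t"
    and "\<forall>q<n * n. m (h + q) = of_bool ({q div n, q mod n} \<in> E)" and "r 0 = 0"
  shows "runs W search_all_com r m
    (3 * n + 3 * (k + t) + 18 + n * (113 * 2 ^ (k + t) * (n * n * n) + 2))
    (\<lambda>r m. r 0 = of_bool (\<exists>s<n. search n E k t 2 s))"
proof -
  define I where "I j r m \<longleftrightarrow> env r m \<and> r 4 = j \<and> j \<le> n \<and>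
    r 0 = of_bool (\<exists>s<n. j \<le> s \<and> search n E k t 2 s)" for j r m
  have init: "runs W (Mov 4 21) r m 1 (I n)" if "env r m" "r 0 = 0" for r m
  proof (rule runs_loop_free)
    have st: "effect (Mov 4 21) (r, m) = (r(4 := n), m)" using that by (simp add: env_def)
    have "env (r(4 := n)) m" by (rule env_cong[of r]) (use that in auto)
    then show "I n (fst (effect (Mov 4 21) (r, m))) (snd (effect (Mov 4 21) (r, m)))"
      unfolding st using that by (auto simp: I_def)
  qed simp_all
  have step: "runs W (Seq (Sub 4 4 5) (search_com 2)) r m
      (1 + 113 * 2 ^ (k + t) * (n * n * n)) (I j)" if I: "I (Suc j) r m" for j r m
  proof (rule runs_Seq)
    have j: "j < n" using I by (simp add: I_def)
    \<comment> \<open>Entering a round supplies a vertex; on the empty graph the loop ends at once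
      and the answer stays 0.\<close>
    then interpret nonempty_instance_in_memory n k t h W E by unfold_locales simp
    let ?a = "of_bool (\<exists>s<n. Suc j \<le> s \<and> search n E k t 2 s)"
    let ?Q = "\<lambda>r m. env r m \<and> r 4 = j \<and> r 0 = ?a"
    show "runs W (Sub 4 4 5) r m 1 ?Q"
    proof (rule runs_loop_free)
      have "r 4 = Suc j" "r 5 = 1" using I by (simp_all add: I_def env_def)
      then have st: "effect (Sub 4 4 5) (r, m) = (r(4 := j), m)" by simp
      have "env (r(4 := j)) m" by (rule env_cong[of r]) (use I in \<open>auto simp: I_def\<close>)
      then show "?Q (fst (effect (Sub 4 4 5) (r, m))) (snd (effect (Sub 4 4 5) (r, m)))"
        unfolding st using I by (simp add: I_def)
    qed simp_all
    fix r m assume Q: "?Q r m"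
    show "runs W (search_com 2) r m (113 * 2 ^ (k + t) * (n * n * n)) (I j)"
    proof (rule runs_mono[OF runs_search[of j 2 r m ?a] order_refl])
      fix r' m' assume 1: "env r' m' \<and> r' 4 = j \<and> r' 0 = (if search n E k t 2 j then 1 else ?a)"
      have "(\<exists>s<n. j \<le> s \<and> search n E k t 2 s) \<longleftrightarrow>
          search n E k t 2 j \<or> (\<exists>s<n. Suc j \<le> s \<and> search n E k t 2 s)"
        using j by (auto simp: Suc_le_eq order_le_less)
      then show "I j r' m'" using 1 j by (auto simp only: I_def split: if_splits) auto
    qed (use j Q in simp_all)
  qed
  have loop: "runs W (WhileNZ 4 (Seq (Sub 4 4 5) (search_com 2))) r m
      (n * (1 + 113 * 2 ^ (k + t) * (n * n * n) + 1) + 1) (I 0)" if "I n r m" for r m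
    using that by (rule runs_WhileNZ[where I = I]) (erule step | simp add: I_def)+
  have "runs W (load_com h) r m (3 * n + 3 * (k + t) + 16)
      (\<lambda>r' m'. env r' m' \<and> r' 0 = 0 \<and> m' = m)"
    by (rule runs_load) fact+
  then have load: "runs W (load_com 3) r m (3 * n + 3 * (k + t) + 16)
      (\<lambda>r' m'. env r' m' \<and> r' 0 = 0 \<and> m' = m)"
    by (simp only: assms(1))
  have "runs W search_all_com r m (3 * n + 3 * (k + t) + 16 + (1 +
      (n * (1 + 113 * 2 ^ (k + t) * (n * n * n) + 1) + 1))) (I 0)"
    unfolding search_all_com_def
    by (rule runs_Seq[OF load], rule runs_Seq[OF init loop]) auto
  then show ?thesis by (rule runs_mono) (auto simp: I_def)
qed

end

lemma (in nonempty_instance_in_memory) runs_search_terminal: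
  assumes "h = 4" "m 0 = n" "m 1 = k" "m 2 = t" "m 3 = s" "s < n" "0 < c" "c \<le> 2"
    and "\<forall>q<n * n. m (h + q) = of_bool ({q div n, q mod n} \<in> E)" and "r 0 = 0"
  shows "runs W (search_terminal_com c) r m
    (3 * n + 3 * (k + t) + 18 + 113 * 2 ^ (k + t) * (n * n * n))
    (\<lambda>r m. r 0 = of_bool (search n E k t c s))"
proof -
  let ?c = "block [Imm 18 3, Load 4 18]"
  let ?Q = "\<lambda>r m'. env r m' \<and> r 0 = 0 \<and> r 4 = s"
  have read: "runs W ?c r' m 2 ?Q" if "env r' m" "r' 0 = 0" for r'
  proof (rule runs_loop_free)
    have st: "effect ?c (r', m) = (r'(18 := 3, 4 := s), m)"
      using assms(5) by (simp add: fun_eq_iff)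
    have "env (r'(18 := 3, 4 := s)) m" by (rule env_cong[of r']) (use that in auto)
    then show "?Q (fst (effect ?c (r', m))) (snd (effect ?c (r', m)))"
      unfolding st using that by simp
  qed (use power_W_ge in simp_all)
  have "runs W (load_com h) r m (3 * n + 3 * (k + t) + 16)
      (\<lambda>r' m'. env r' m' \<and> r' 0 = 0 \<and> m' = m)"
    by (rule runs_load) fact+
  then have load: "runs W (load_com 4) r m (3 * n + 3 * (k + t) + 16)
      (\<lambda>r' m'. env r' m' \<and> r' 0 = 0 \<and> m' = m)"
    by (simp only: assms(1))
  have "runs W (search_terminal_com c) r m (3 * n + 3 * (k + t) + 16 + (2 +
      113 * 2 ^ (k + t) * (n * n * n)))
      (\<lambda>r m. env r m \<and> r 4 = s \<and> r 0 = (if search n E k t c s then 1 else 0))"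
    unfolding search_terminal_com_def
  proof (rule runs_Seq[OF load])
    fix r' m' assume "env r' m' \<and> r' 0 = 0 \<and> m' = m"
    then show "runs W (Seq ?c (search_com c)) r' m' (2 + 113 * 2 ^ (k + t) * (n * n * n))
      (\<lambda>r m. env r m \<and> r 4 = s \<and> r 0 = (if search n E k t c s then 1 else 0))"
      using runs_Seq[OF read runs_search] assms(6-8) by blast
  qed
  then show ?thesis by (rule runs_mono) auto
qed

section \<open>Input layout and the final time bound\<close>

lemma concat_rows:
  fixes f :: "nat \<Rightarrow> nat \<Rightarrow> 'b"
  shows "length (concat (map (\<lambda>u. map (f u) [0..<n]) [0..<j])) = j * n"
    and "q < j * n \<Longrightarrow>
      concat (map (\<lambda>u. map (f u) [0..<n]) [0..<j]) ! q = f (q div n) (q mod n)"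
proof -
  show len: "length (concat (map (\<lambda>u. map (f u) [0..<n]) [0..<j])) = j * n" for j
    by (induction j) simp_all
  show "concat (map (\<lambda>u. map (f u) [0..<n]) [0..<j]) ! q = f (q div n) (q mod n)" if "q < j * n"
    using that
  proof (induction j)
    case (Suc j)
    show ?case
    proof (cases "q < j * n")
      case True
      then show ?thesis using Suc.IH by (simp add: nth_append len)
    next
      case False
      define i where "i = q - j * n"
      have "q = j * n + i" "i < n" using False Suc.prems by (simp_all add: i_def)
      then show ?thesis by (simp add: nth_append len)
    qed
  qed simp
qed

lemma length_adjacency_matrix: "length (adjacency_matrix n E) = n * n"
  unfolding adjacency_matrix_def by (rule concat_rows(1))

lemma nth_adjacency_matrix:
  "q < n * n \<Longrightarrow> adjacency_matrix n E ! q = of_bool ({q div n, q mod n} \<in> E)"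
  unfolding adjacency_matrix_def by (rule concat_rows(2))

text \<open>From 2 on the exponent is at least 1, and at 1 both sides are 1. This absorbs a factor
  \<open>k + t\<close> into the quasi-polynomial term.\<close>

lemma le_powr_log:
  assumes "1 \<le> (x :: nat)"
  shows "real x \<le> real x powr (1 * log 2 (real x))"
proof (cases "x = 1")
  case False
  then have "1 \<le> log 2 (real x)" using assms by (simp add: le_log_iff)
  then have "real x powr 1 \<le> real x powr (1 * log 2 (real x))"
    using assms by (intro powr_mono) simp_all
  then show ?thesis by simp
qed simp

text \<open>The logarithmic cost contributes \<open>2 * W\<close>, at most 24 times
  \<open>k + t\<close> times the square of \<open>max 1 n\<close>. Hence the constant 3600 = 2 * 12
  * 150 and the exponent 6 = 2 + 4.\<close>

lemma decides_within_runs: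
  assumes "runs W p (\<lambda>_. 0) (snd (initial_state (xs @ adjacency_matrix n E))) B
      (\<lambda>r m. r 0 = of_bool ans)"
    and W: "W = k + t + n * n + n + h + 5" "h \<le> 4"
    and xs: "\<forall>x\<in>set xs. x \<le> W" and "1 \<le> k + t"
    and B: "B \<le> 150 * (2 ^ (k + t) * max 1 n ^ 4)"
  shows "decides_within p (xs @ adjacency_matrix n E) ans (time_bound 3600 1 6 n k t)"
proof -
  let ?st = "initial_state (xs @ adjacency_matrix n E)"
  have "x < 2 ^ W" if "x \<in> set (xs @ adjacency_matrix n E)" for x
  proof -
    have "x \<le> W" using that xs W(1) by (auto simp: adjacency_matrix_def)
    then show ?thesis using less_exp[of W] by linarith
  qed
  then have "bounded W (\<lambda>_. 0) (snd ?st)"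
    using W(1) unfolding bounded_def initial_state_def
    by (auto simp del: set_append dest: nth_mem)
  then obtain T r m where T: "exec p ?st T (r, m)" "T \<le> 2 * W * B" "r 0 = of_bool ans"
    using assms(1) unfolding runs_def by (auto simp: initial_state_def)
  define N where "N = max 1 n"
  have N: "1 \<le> N" "n \<le> N" by (simp_all add: N_def)
  have L: "1 \<le> k + t" by fact
  define M where "M = (k + t) * (N * N)"
  have "n * n \<le> N * N" "n * 1 \<le> N * N" "1 * 1 \<le> N * N"
    using N by (intro mult_le_mono; simp)+
  moreover have "(k + t) * 1 \<le> M" "1 * (N * N) \<le> M"
    unfolding M_def using N L by (intro mult_le_mono; simp)+
  \<comment> \<open>The terms \<open>k + t\<close>, \<open>n * n\<close> and \<open>n\<close> cost
    one \<open>M\<close> each, and \<open>h + 5\<close> at most nine.\<close>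
  ultimately have "W \<le> 12 * M" using W by (simp only: mult_1 mult_1_right)
  then have "W \<le> 12 * ((k + t) * (N * N))" by (simp only: M_def)
  then have "2 * W * B \<le> 2 * (12 * ((k + t) * (N * N))) * (150 * (2 ^ (k + t) * N ^ 4))"
    using B unfolding N_def by (intro mult_le_mono) simp_all
  also have "\<dots> = 3600 * 2 ^ (k + t) * (k + t) * (N * N * N ^ 4)"
    by (simp only: ac_simps)
  also have "N * N * N ^ 4 = N ^ 6"
    by (simp flip: power2_eq_square power_add)
  finally have "T \<le> 3600 * 2 ^ (k + t) * (k + t) * N ^ 6" using T(2) by linarith
  then have "real T \<le> real (3600 * 2 ^ (k + t) * (k + t) * N ^ 6)" by (rule of_nat_mono)
  also have "\<dots> = 3600 * 2 ^ (k + t) * real (k + t) * real N ^ 6" by simp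
  also have "\<dots> \<le> 3600 * 2 ^ (k + t) * real (k + t) powr (1 * log 2 (real (k + t))) * real N ^ 6"
    by (intro mult_right_mono mult_left_mono le_powr_log L) simp_all
  finally have "real T \<le> time_bound 3600 1 6 n k t" by (simp only: time_bound_def N_def)
  then show ?thesis using T(1,3) unfolding decides_within_def by blast
qed

text \<open>Since \<open>k + t \<le> 2 ^ (k + t)\<close>, every term is a multiple of the common
  product; the coefficients sum to 139 and 137.\<close>

lemma step_bounds:
  fixes n k t :: nat
  shows "3 * n + 3 * (k + t) + 18 + n * (113 * 2 ^ (k + t) * (n * n * n) + 2)
      \<le> 150 * (2 ^ (k + t) * max 1 n ^ 4)"
    and "3 * n + 3 * (k + t) + 18 + 113 * 2 ^ (k + t) * (n * n * n)
      \<le> 150 * (2 ^ (k + t) * max 1 n ^ 4)"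
proof -
  define N where "N = max 1 n"
  define P where "P = (2::nat) ^ (k + t)"
  define M where "M = P * N ^ 4"
  have N: "1 \<le> N" "n \<le> N" by (simp_all add: N_def)
  have P: "1 \<le> P" "k + t \<le> P" by (simp_all add: P_def less_imp_le)
  have "n ^ 3 \<le> N ^ 3" "N ^ 3 \<le> N ^ 4" "n ^ 4 \<le> N ^ 4"
    using N by (simp_all add: power_increasing power_mono)
  then have "n ^ 3 \<le> N ^ 4" "n ^ 4 \<le> N ^ 4" by linarith+
  moreover have "n \<le> N ^ 4" using power_increasing[of 1 4 N] N by simp
  moreover have "1 \<le> N ^ 4" using N by simp
  ultimately have "1 * 1 \<le> M" "1 * n \<le> M" "(k + t) * 1 \<le> M" "P * n ^ 4 \<le> M" "P * n ^ 3 \<le> M"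
    unfolding M_def using N P by (intro mult_le_mono; simp)+
  moreover have "n * (113 * P * (n * n * n) + 2) = 113 * (P * n ^ 4) + 2 * n"
    "113 * P * (n * n * n) = 113 * (P * n ^ 3)"
    by (simp_all add: power3_eq_cube power4_eq_xxxx distrib_left mult.left_commute)
  ultimately show "3 * n + 3 * (k + t) + 18 + n * (113 * 2 ^ (k + t) * (n * n * n) + 2)
      \<le> 150 * (2 ^ (k + t) * max 1 n ^ 4)"
    and "3 * n + 3 * (k + t) + 18 + 113 * 2 ^ (k + t) * (n * n * n)
      \<le> 150 * (2 ^ (k + t) * max 1 n ^ 4)"
    unfolding P_def[symmetric] N_def[symmetric] M_def[symmetric] by linarith+
qed

lemma decides_search_all:
  assumes "1 \<le> k"
  shows "decides_within search_all_com ([n, k, t] @ adjacency_matrix n E)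
    (\<exists>s<n. search n E k t 2 s) (time_bound 3600 1 6 n k t)"
proof -
  define W where "W = k + t + n * n + n + 3 + 5"
  interpret instance_in_memory n k t 3 W E by unfold_locales (simp add: W_def)
  show ?thesis
  proof (rule decides_within_runs[OF runs_search_all W_def])
    show "3 * n + 3 * (k + t) + 18 + n * (113 * 2 ^ (k + t) * (n * n * n) + 2) \<le> 150 * (2 ^ (k + t) * max 1 n ^ 4)"
      by (rule step_bounds)
    show "\<forall>q<n * n. snd (initial_state ([n, k, t] @ adjacency_matrix n E)) (3 + q) =
        of_bool ({q div n, q mod n} \<in> E)"
      by (simp add: initial_state_def length_adjacency_matrix nth_adjacency_matrix nth_append)
  qed (use assms in \<open>auto simp: initial_state_def length_adjacency_matrix W_def\<close>)
qed

lemma decides_search_terminal: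
  assumes "1 \<le> k" "s < n" "0 < c" "c \<le> 2"
  shows "decides_within (search_terminal_com c) ([n, k, t, s] @ adjacency_matrix n E)
    (search n E k t c s) (time_bound 3600 1 6 n k t)"
proof -
  define W where "W = k + t + n * n + n + 4 + 5"
  interpret nonempty_instance_in_memory n k t 4 W E
    by unfold_locales (use assms(2) in \<open>simp_all add: W_def\<close>)
  show ?thesis
  proof (rule decides_within_runs[OF runs_search_terminal W_def])
    show "3 * n + 3 * (k + t) + 18 + 113 * 2 ^ (k + t) * (n * n * n) \<le> 150 * (2 ^ (k + t) * max 1 n ^ 4)"
      by (rule step_bounds)
    show "\<forall>q<n * n. snd (initial_state ([n, k, t, s] @ adjacency_matrix n E)) (4 + q) =
        of_bool ({q div n, q mod n} \<in> E)"
      by (simp add: initial_state_def length_adjacency_matrix nth_adjacency_matrix nth_append)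
  qed (use assms in \<open>auto simp: initial_state_def length_adjacency_matrix W_def\<close>)
qed

theorem theorem1:
  shows
    "(\<exists>p C a c. \<forall>n E k t.
        simple_graph {..<n} E \<and> k \<ge> 1 \<longrightarrow>
        decides_within p ([n, k, t] @ adjacency_matrix n E)
          (cutting_vertices {..<n} E k t)
          (time_bound C a c n k t))
   \<and> (\<exists>p C a c. \<forall>n E s k t.
        simple_graph {..<n} E \<and> s \<in> {..<n} \<and> k \<ge> 1 \<longrightarrow>
        decides_within p ([n, k, t, s] @ adjacency_matrix n E)
          (cutting_vertices_terminal {..<n} E s k t)
          (time_bound C a c n k t))
   \<and> (\<exists>p C a c. \<forall>n E s k t.
        simple_graph {..<n} E \<and> s \<in> {..<n} \<and> k \<ge> 1 \<longrightarrow>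
        decides_within p ([n, k, t, s] @ adjacency_matrix n E)
          (cutting_vertices_edge_cut_terminal {..<n} E s k t)
          (time_bound C a c n k t))"
\<comment> \<open>The witnesses stay open here and are fixed by the three \<open>show\<close>
  commands: \<open>C = 3600\<close>, \<open>a = 1\<close> and \<open>c = 6\<close> serve all
  problems.\<close>
proof (intro conjI exI allI impI)
  fix n :: nat and E and k t :: nat assume "simple_graph {..<n} E \<and> 1 \<le> k"
  \<comment> \<open>A solution is non-empty, so any of its vertices can act as the terminal.\<close>
  moreover have "cutting_vertices {..<n} E k t \<longleftrightarrow> (\<exists>s<n. search n E k t 2 s)"
    unfolding cutting_vertices_iff_terminal using search_vertices by blast
  ultimately show "decides_within search_all_com ([n, k, t] @ adjacency_matrix n E)
      (cutting_vertices {..<n} E k t) (time_bound 3600 1 6 n k t)"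
    using decides_search_all by simp
next
  fix n :: nat and E and s k t :: nat assume "simple_graph {..<n} E \<and> s \<in> {..<n} \<and> 1 \<le> k"
  then have "s < n" "1 \<le> k" by simp_all
  then show "decides_within (search_terminal_com 2) ([n, k, t, s] @ adjacency_matrix n E)
      (cutting_vertices_terminal {..<n} E s k t) (time_bound 3600 1 6 n k t)"
    using decides_search_terminal[of k s n 2] by (simp only: search_vertices)
next
  fix n :: nat and E and s k t :: nat assume "simple_graph {..<n} E \<and> s \<in> {..<n} \<and> 1 \<le> k"
  then have "s < n" "1 \<le> k" by simp_all
  then show "decides_within (search_terminal_com 1) ([n, k, t, s] @ adjacency_matrix n E)
      (cutting_vertices_edge_cut_terminal {..<n} E s k t) (time_bound 3600 1 6 n k t)"
    using decides_search_terminal[of k s n 1] by (simp only: search_edges)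
qed

end
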